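(* For every $n\geq 1$ there exists a saturated $n$-topological space $(X,\tau_1,\dots,\tau_n)$ in which $\#\mathcal{KF}_n^0=p(n)$ and $\#\mathcal{KF}_n=2p(n)$, where $$p(n)=\frac{5}{24}n^4+\frac{37}{12}n^3+\frac{79}{24}n^2+\frac{101}{12}n+2.$$ In fact, (in such a space) there is an initial set $A\subseteq X$ such that $\#\{oA:o\in\mathcal{KF}_n\}=2p(n)$.
   Context: An $n$-topological space $(X,\tau_1,\dots,\tau_n)$ is a set $X$ equipped with topologies $\tau_1\supseteq\tau_2\supseteq\dots\supseteq\tau_n$. It is saturated if whenever $1\leq x,y\leq n$ and $U$ is a nonempty $\tau_x$-open set, the $\tau_y$-interior of $U$ is nonempty. A set operator is a map from the power set of $X$ to itself; operators are composed by juxtaposition (rightmost applied first). For $1\leq j\leq n$, $k_j$, $i_j$ and $f_j$ denote the closure, interior and frontier operators of $\tau_j$, where $f_jA=k_jA\cap k_j(X\setminus A)$; $c$ denotes the complement operator $cA=X\setminus A$. $\mathcal{KF}_n=\mathcal{KF}_n(X,\tau_1,\dots,\tau_n)$ is the smallest monoid of set operators (under composition, containing the identity operator) containing $k_j,f_j$ ($1\leq j\leq n$) and $c$. $\mathcal{KF}_n^0=\mathcal{KF}_n^0(X,\tau_1,\dots,\tau_n)$ is the smallest monoid of set operators containing $k_j,i_j,f_j$ ($1\leq j\leq n$). $\#$ denotes cardinality. *)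

theory Defs
  imports "HOL-Analysis.Analysis"
begin

definition n_topological_space :: "nat \<Rightarrow> 'a set \<Rightarrow> (nat \<Rightarrow> 'a topology) \<Rightarrow> bool" where
  "n_topological_space n X \<tau> \<longleftrightarrow>
     (\<forall>j\<in>{1..n}. topspace (\<tau> j) = X) \<and>
     (\<forall>j\<in>{1..<n}. {U. openin (\<tau> j) U} \<supseteq> {U. openin (\<tau> (Suc j)) U})"

definition saturated :: "nat \<Rightarrow> (nat \<Rightarrow> 'a topology) \<Rightarrow> bool" where
  "saturated n \<tau> \<longleftrightarrow>
     (\<forall>x\<in>{1..n}. \<forall>y\<in>{1..n}. \<forall>U. openin (\<tau> x) U \<and> U \<noteq> {} \<longrightarrow> \<tau> y interior_of U \<noteq> {})"

text \<open>
  A set operator on \<open>X\<close> is a map from \<open>Pow X\<close> to itself, represented as an element of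
  \<open>Pow X \<rightarrow>\<^sub>E Pow X\<close>. Operators are \<open>undefined\<close> outside \<open>Pow X\<close>, so that HOL equality
  (hence cardinality) only sees their values on subsets of \<open>X\<close>.
\<close>

definition closure_op :: "'a set \<Rightarrow> 'a topology \<Rightarrow> 'a set \<Rightarrow> 'a set" where
  "closure_op X T = (\<lambda>A\<in>Pow X. T closure_of A)"

definition interior_op :: "'a set \<Rightarrow> 'a topology \<Rightarrow> 'a set \<Rightarrow> 'a set" where
  "interior_op X T = (\<lambda>A\<in>Pow X. T interior_of A)"

definition frontier_op :: "'a set \<Rightarrow> 'a topology \<Rightarrow> 'a set \<Rightarrow> 'a set" where
  "frontier_op X T = (\<lambda>A\<in>Pow X. T closure_of A \<inter> T closure_of (X - A))"

definition complement_op :: "'a set \<Rightarrow> 'a set \<Rightarrow> 'a set" where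
  "complement_op X = (\<lambda>A\<in>Pow X. X - A)"

inductive_set generated_monoid :: "'a set \<Rightarrow> ('a set \<Rightarrow> 'a set) set \<Rightarrow> ('a set \<Rightarrow> 'a set) set"
  for X :: "'a set" and G :: "('a set \<Rightarrow> 'a set) set" where
  one: "(\<lambda>A\<in>Pow X. A) \<in> generated_monoid X G"
| gen: "g \<in> G \<Longrightarrow> g \<in> generated_monoid X G"
| mult: "\<lbrakk>f \<in> generated_monoid X G; g \<in> generated_monoid X G\<rbrakk>
    \<Longrightarrow> compose (Pow X) f g \<in> generated_monoid X G"

definition KF :: "nat \<Rightarrow> 'a set \<Rightarrow> (nat \<Rightarrow> 'a topology) \<Rightarrow> ('a set \<Rightarrow> 'a set) set" where
  "KF n X \<tau> = generated_monoid X
     ((\<Union>j\<in>{1..n}. {closure_op X (\<tau> j), frontier_op X (\<tau> j)}) \<union> {complement_op X})"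

definition KF0 :: "nat \<Rightarrow> 'a set \<Rightarrow> (nat \<Rightarrow> 'a topology) \<Rightarrow> ('a set \<Rightarrow> 'a set) set" where
  "KF0 n X \<tau> = generated_monoid X
     (\<Union>j\<in>{1..n}. {closure_op X (\<tau> j), interior_op X (\<tau> j), frontier_op X (\<tau> j)})"

definition kf_poly :: "nat \<Rightarrow> real" where
  "kf_poly n = 5/24 * real n ^ 4 + 37/12 * real n ^ 3 + 79/24 * real n ^ 2 + 101/12 * real n + 2"

end

theory Submission
  imports Defs
begin

text \<open>
  In a saturated space \<open>k\<^sub>y i\<^sub>x\<close>, \<open>i\<^sub>y k\<^sub>x\<close> and \<open>i\<^sub>y f\<^sub>x\<close> do not depend on \<open>x\<close>, frontiers of
  closed or open sets are nowhere dense in all topologies at once, and \<open>f\<^sub>z k\<^sub>a = f\<^sub>z k\<^bsub>max z a\<^esub>\<close>,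
  \<open>f\<^sub>z i\<^sub>a = f\<^sub>z i\<^bsub>max z a\<^esub>\<close>. Hence every element of \<open>KF\<^sub>n\<^sup>0\<close> is one of \<open>p(n)\<close> normal forms:
  a stem (\<open>1\<close>, \<open>k\<close>, \<open>i\<close>, \<open>ki\<close>, \<open>ik\<close>, \<open>kik\<close>, \<open>iki\<close>, \<open>k\<^sub>y f\<^sub>x\<close>, \<open>if\<close>, \<open>kif\<close>), a composite \<open>k\<^sub>y f\<^sub>z w\<close> with
  \<open>z \<le> y\<close> and \<open>w\<close> a stem, or the constant \<open>\<emptyset>\<close>; and \<open>KF\<^sub>n\<close> consists of these and their complements.

  For sharpness, take a set of points with nested preorders of depth at most three, with the
  up-closed sets as open sets. Its maximal clusters are common to all the preorders, which is
  exactly saturation. A point of the middle layer sees each kind of cluster (disjoint from \<open>A\<close>,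
  inside \<open>A\<close>, meeting both \<open>A\<close> and its complement) from a prescribed index on, so the indices of a
  normal form \<open>o\<close> are read off from which of these points belong to \<open>oA\<close>. A cluster disjoint from
  \<open>A\<close> is disjoint from every such \<open>oA\<close>, which separates the normal forms from their complements.
\<close>

section \<open>Normal forms and their number\<close>

datatype stem =
    Id_stem
  | K_stem nat | I_stem nat | KI_stem nat | IK_stem nat | KIK_stem nat | IKI_stem nat
  | KF_stem nat nat | IF_stem nat | KIF_stem nat

datatype normal_form = Stem stem | KF_of nat nat stem | Empty_form

text \<open>Closure and interior are parameters, so that the same terms can be read in a saturated
  space and in the order model with \<open>cl\<close> and \<open>intr\<close>. Inner operators whose
  index has no influence in a saturated space carry the index 1; the frontier is closure minus
  interior.\<close>

fun eval_stem :: "(nat \<Rightarrow> 'a set \<Rightarrow> 'a set) \<Rightarrow> (nat \<Rightarrow> 'a set \<Rightarrow> 'a set) \<Rightarrow> stem \<Rightarrow> 'a set \<Rightarrow> 'a set"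
  where
    "eval_stem k i Id_stem S = S"
  | "eval_stem k i (K_stem a) S = k a S"
  | "eval_stem k i (I_stem a) S = i a S"
  | "eval_stem k i (KI_stem a) S = k a (i 1 S)"
  | "eval_stem k i (IK_stem a) S = i a (k 1 S)"
  | "eval_stem k i (KIK_stem a) S = k a (i 1 (k 1 S))"
  | "eval_stem k i (IKI_stem a) S = i a (k 1 (i 1 S))"
  | "eval_stem k i (KF_stem y x) S = k y (k x S - i x S)"
  | "eval_stem k i (IF_stem a) S = i a (k 1 S - i 1 S)"
  | "eval_stem k i (KIF_stem a) S = k a (i 1 (k 1 S - i 1 S))"

fun eval_nf ::
  "(nat \<Rightarrow> 'a set \<Rightarrow> 'a set) \<Rightarrow> (nat \<Rightarrow> 'a set \<Rightarrow> 'a set) \<Rightarrow> normal_form \<Rightarrow> 'a set \<Rightarrow> 'a set"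
  where
    "eval_nf k i (Stem w) S = eval_stem k i w S"
  | "eval_nf k i (KF_of y z w) S = k y (k z (eval_stem k i w S) - i z (eval_stem k i w S))"
  | "eval_nf k i Empty_form S = {}"

text \<open>Only \<open>x \<le> y\<close> occurs in \<open>KF_stem y x\<close>: a frontier for the
  index \<open>x\<close> is also closed for every smaller index, so for \<open>y < x\<close> the
  closure changes nothing and the form is \<open>KF_stem x x\<close>.\<close>

definition stems :: "nat \<Rightarrow> stem set" where
  "stems n = insert Id_stem
     (K_stem ` {1..n} \<union> I_stem ` {1..n} \<union> KI_stem ` {1..n} \<union> IK_stem ` {1..n} \<union>
      KIK_stem ` {1..n} \<union> IKI_stem ` {1..n} \<union> IF_stem ` {1..n} \<union> KIF_stem ` {1..n} \<union>
      (\<Union>y\<in>{1..n}. KF_stem y ` {1..y}))"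

text \<open>
  Since \<open>f\<^sub>z i\<^sub>z k = f\<^sub>z k\<^sub>z i k\<close> (and likewise with \<open>ki\<close> or \<open>f\<close> in place of \<open>k\<close>), the
  stems starting with \<open>i\<^sub>z\<close> are omitted for these families.
\<close>
definition inner_stems :: "nat \<Rightarrow> nat \<Rightarrow> stem set" where
  "inner_stems n z =
     K_stem ` {z..n} \<union> I_stem ` {z..n} \<union> KI_stem ` {z..n} \<union> IKI_stem ` {z<..n} \<union>
     KIK_stem ` {z..n} \<union> IK_stem ` {z<..n} \<union> KIF_stem ` {z..n} \<union> IF_stem ` {z<..n} \<union>
     (\<Union>a\<in>{z..n}. KF_stem a ` {1..a})"

definition normal_forms :: "nat \<Rightarrow> normal_form set" where
  "normal_forms n = insert Empty_form
     (Stem ` stems n \<union> (\<Union>z\<in>{1..n}. \<Union>y\<in>{z..n}. KF_of y z ` inner_stems n z))"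

section \<open>Counting the normal forms\<close>

lemma stems_simps:
  "Id_stem \<in> stems n"
  "K_stem a \<in> stems n \<longleftrightarrow> a \<in> {1..n}"
  "I_stem a \<in> stems n \<longleftrightarrow> a \<in> {1..n}"
  "KI_stem a \<in> stems n \<longleftrightarrow> a \<in> {1..n}"
  "IK_stem a \<in> stems n \<longleftrightarrow> a \<in> {1..n}"
  "KIK_stem a \<in> stems n \<longleftrightarrow> a \<in> {1..n}"
  "IKI_stem a \<in> stems n \<longleftrightarrow> a \<in> {1..n}"
  "IF_stem a \<in> stems n \<longleftrightarrow> a \<in> {1..n}"
  "KIF_stem a \<in> stems n \<longleftrightarrow> a \<in> {1..n}"
  "KF_stem y x \<in> stems n \<longleftrightarrow> y \<in> {1..n} \<and> x \<in> {1..n} \<and> x \<le> y"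
  unfolding stems_def by fastforce+

lemma inner_stems_simps:
  "Id_stem \<notin> inner_stems n z"
  "K_stem a \<in> inner_stems n z \<longleftrightarrow> z \<le> a \<and> a \<le> n"
  "I_stem a \<in> inner_stems n z \<longleftrightarrow> z \<le> a \<and> a \<le> n"
  "KI_stem a \<in> inner_stems n z \<longleftrightarrow> z \<le> a \<and> a \<le> n"
  "IK_stem a \<in> inner_stems n z \<longleftrightarrow> z < a \<and> a \<le> n"
  "KIK_stem a \<in> inner_stems n z \<longleftrightarrow> z \<le> a \<and> a \<le> n"
  "IKI_stem a \<in> inner_stems n z \<longleftrightarrow> z < a \<and> a \<le> n"
  "IF_stem a \<in> inner_stems n z \<longleftrightarrow> z < a \<and> a \<le> n"
  "KIF_stem a \<in> inner_stems n z \<longleftrightarrow> z \<le> a \<and> a \<le> n"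
  "KF_stem a x \<in> inner_stems n z \<longleftrightarrow> z \<le> a \<and> a \<le> n \<and> 1 \<le> x \<and> x \<le> a"
  unfolding inner_stems_def by fastforce+

lemma card_stems: "card (stems n) = 1 + 8 * n + (\<Sum>y=1..n. y)"
proof -
  have u: "card (\<Union>y\<in>{1..n}. KF_stem y ` {1..y}) = (\<Sum>y=1..n. y)"
    by (subst card_UN_disjoint) (auto simp: card_image inj_on_def)
  have "finite (\<Union>y\<in>{1..n}. KF_stem y ` {1..y})" by auto
  then show ?thesis
    unfolding stems_def
    by (subst card_insert_disjoint, (auto)[2], (subst card_Un_disjoint, (auto)[3])+)
       (simp add: u card_image inj_on_def del: One_nat_def)
qed

text \<open>Five families are indexed by \<open>{z..n}\<close> and three by \<open>{z<..n}\<close>,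
  which gives \<open>5 * (n - z + 1) + 3 * (n - z)\<close>; the sum counts the pairs in
  \<open>KF_stem\<close>.\<close>

lemma card_inner_stems:
  assumes "z \<le> n"
  shows "card (inner_stems n z) = 8 * (n - z) + 5 + (\<Sum>a=z..n. a)"
proof -
  have u: "card (\<Union>a\<in>{z..n}. KF_stem a ` {1..a}) = (\<Sum>a=z..n. a)"
    by (subst card_UN_disjoint) (auto simp: card_image inj_on_def)
  show ?thesis
    unfolding inner_stems_def
    using assms
    by ((subst card_Un_disjoint, (auto)[3])+) (simp add: u card_image inj_on_def Suc_diff_le del: One_nat_def)
qed

lemma finite_inner_stems: "finite (inner_stems n z)"
  by (simp add: inner_stems_def)

lemma finite_normal_forms: "finite (normal_forms n)"
  by (simp add: normal_forms_def stems_def finite_inner_stems)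

lemma card_normal_forms_nat:
  "card (normal_forms n) = 2 + 8 * n + (\<Sum>y=1..n. y) +
     (\<Sum>z=1..n. (Suc n - z) * (8 * (n - z) + 5 + (\<Sum>a=z..n. a)))"
proof -
  have y: "card (\<Union>y\<in>{z..n}. KF_of y z ` inner_stems n z) =
      (Suc n - z) * (8 * (n - z) + 5 + (\<Sum>a=z..n. a))" if "z \<in> {1..n}" for z
  proof -
    have "card (\<Union>y\<in>{z..n}. KF_of y z ` inner_stems n z) = (\<Sum>y=z..n. card (inner_stems n z))"
      by (subst card_UN_disjoint) (auto simp: card_image inj_on_def finite_inner_stems)
    with that show ?thesis by (simp add: card_inner_stems)
  qed
  have z: "card (\<Union>z\<in>{1..n}. \<Union>y\<in>{z..n}. KF_of y z ` inner_stems n z) =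
      (\<Sum>z=1..n. card (\<Union>y\<in>{z..n}. KF_of y z ` inner_stems n z))"
    by (rule card_UN_disjoint) (auto simp: finite_inner_stems)
  have "card (normal_forms n) =
      Suc (card (Stem ` stems n \<union> (\<Union>z\<in>{1..n}. \<Union>y\<in>{z..n}. KF_of y z ` inner_stems n z)))"
    unfolding normal_forms_def
    by (rule card_insert_disjoint) (auto simp: finite_inner_stems stems_def)
  also have "\<dots> = Suc (card (Stem ` stems n) +
      card (\<Union>z\<in>{1..n}. \<Union>y\<in>{z..n}. KF_of y z ` inner_stems n z))"
    by (subst card_Un_disjoint) (auto simp: finite_inner_stems stems_def)
  also have "card (Stem ` stems n) = card (stems n)"
    by (simp add: card_image inj_on_def)
  finally show ?thesis
    using z y by (simp add: card_stems)
qed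

lemma sum_from_to: "z \<le> n \<Longrightarrow> real (\<Sum>a=z..n. a) = real (Suc n - z) * (2 * real n - real (n - z)) / 2"
proof (induction n)
  case (Suc n)
  show ?case
  proof (cases "z = Suc n")
    case False
    with Suc show ?thesis by (simp add: of_nat_diff field_simps Suc_diff_le)
  qed simp
qed simp

text \<open>The count over \<open>z\<close> becomes this sum under \<open>m = Suc n - z\<close>. The
  parameter \<open>c\<close>, later \<open>n\<close>, is kept apart from the upper bound
  \<open>N\<close> so that induction on \<open>N\<close> leaves it fixed.\<close>

lemma sum_form_count:
  "(\<Sum>m=1..N. real m * (8 * (real m - 1) + 5 + real m * (2 * c + 1 - real m) / 2)) =
   8 * real N * (real N + 1) * (2 * real N + 1) / 6 - 3 * real N * (real N + 1) / 2
   + (2 * c + 1) * real N * (real N + 1) * (2 * real N + 1) / 12 - (real N * (real N + 1))^2 / 8"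
  by (induction N) (simp_all add: field_simps power2_eq_square)

lemma card_normal_forms: "real (card (normal_forms n)) = kf_poly n"
proof -
  have "real (\<Sum>z=1..n. (Suc n - z) * (8 * (n - z) + 5 + (\<Sum>a=z..n. a))) =
      (\<Sum>z=1..n. real ((Suc n - z) * (8 * (n - z) + 5)) + real (Suc n - z) * real (\<Sum>a=z..n. a))"
    by (simp only: of_nat_sum of_nat_add of_nat_mult distrib_left)
  also have "\<dots> = (\<Sum>z=1..n. real (Suc n - z) * (8 * (real (Suc n - z) - 1) + 5 +
      real (Suc n - z) * (2 * real n + 1 - real (Suc n - z)) / 2))"
    by (rule sum.cong) (auto simp: sum_from_to of_nat_diff field_simps Suc_diff_le simp del: of_nat_sum)
  also have "\<dots> = (\<Sum>m=1..n. real m * (8 * (real m - 1) + 5 + real m * (2 * real n + 1 - real m) / 2))"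
    by (rule sum.reindex_bij_witness[of _ "\<lambda>m. Suc n - m" "\<lambda>m. Suc n - m"]) auto
  also have "\<dots> = 8 * real n * (real n + 1) * (2 * real n + 1) / 6 - 3 * real n * (real n + 1) / 2
   + (2 * real n + 1) * real n * (real n + 1) * (2 * real n + 1) / 12 - (real n * (real n + 1))^2 / 8"
    by (rule sum_form_count)
  finally have s: "real (\<Sum>z=1..n. (Suc n - z) * (8 * (n - z) + 5 + (\<Sum>a=z..n. a))) = \<dots>" .
  have "real (\<Sum>y=1..n. y) = real n * (real n + 1) / 2"
    by (induction n) (auto simp: field_simps)
  with s show ?thesis
    unfolding card_normal_forms_nat kf_poly_def
    by (simp add: field_simps power2_eq_square power3_eq_cube power4_eq_xxxx del: of_nat_sum)
qed

section \<open>Normal forms in saturated spaces\<close>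

text \<open>Multiplication from the left, computed on terms. Adjacent operators of one kind merge
  into the larger index, an operator of the other kind makes the inner index irrelevant, and the
  Kuratowski identities \<open>kiki = ki\<close> and \<open>ikik = ik\<close> shorten longer
  words.\<close>

fun cl_stem :: "nat \<Rightarrow> stem \<Rightarrow> stem" where
  "cl_stem j Id_stem = K_stem j"
| "cl_stem j (K_stem a) = K_stem (max j a)"
| "cl_stem j (I_stem a) = KI_stem j"
| "cl_stem j (KI_stem a) = KI_stem (max j a)"
| "cl_stem j (IK_stem a) = KIK_stem j"
| "cl_stem j (KIK_stem a) = KIK_stem (max j a)"
| "cl_stem j (IKI_stem a) = KI_stem j"
| "cl_stem j (KF_stem y x) = KF_stem (max j y) x"
| "cl_stem j (IF_stem a) = KIF_stem j"
| "cl_stem j (KIF_stem a) = KIF_stem (max j a)"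

fun int_stem :: "nat \<Rightarrow> stem \<Rightarrow> stem" where
  "int_stem j Id_stem = I_stem j"
| "int_stem j (K_stem a) = IK_stem j"
| "int_stem j (I_stem a) = I_stem (max j a)"
| "int_stem j (KI_stem a) = IKI_stem j"
| "int_stem j (IK_stem a) = IK_stem (max j a)"
| "int_stem j (KIK_stem a) = IK_stem j"
| "int_stem j (IKI_stem a) = IKI_stem (max j a)"
| "int_stem j (KF_stem y x) = IF_stem j"
| "int_stem j (IF_stem a) = IF_stem (max j a)"
| "int_stem j (KIF_stem a) = IF_stem j"

text \<open>A frontier equals its own closure for the same index, whence the outer
  \<open>KF_of j j\<close>. The case distinctions avoid the stems that \<open>inner_stems\<close>
  omits.\<close>

fun frontier_stem :: "nat \<Rightarrow> stem \<Rightarrow> normal_form" where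
  "frontier_stem j Id_stem = Stem (KF_stem j j)"
| "frontier_stem j (K_stem a) = KF_of j j (K_stem (max j a))"
| "frontier_stem j (I_stem a) = KF_of j j (I_stem (max j a))"
| "frontier_stem j (KI_stem a) = KF_of j j (KI_stem (max j a))"
| "frontier_stem j (IK_stem a) = KF_of j j (if a \<le> j then KIK_stem j else IK_stem a)"
| "frontier_stem j (KIK_stem a) = KF_of j j (KIK_stem (max j a))"
| "frontier_stem j (IKI_stem a) = KF_of j j (if a \<le> j then KI_stem j else IKI_stem a)"
| "frontier_stem j (KF_stem y x) = KF_of j j (KF_stem (max j y) x)"
| "frontier_stem j (IF_stem a) = KF_of j j (if a \<le> j then KIF_stem j else IF_stem a)"
| "frontier_stem j (KIF_stem a) = KF_of j j (KIF_stem (max j a))"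

fun cl_nf :: "nat \<Rightarrow> normal_form \<Rightarrow> normal_form" where
  "cl_nf j (Stem w) = Stem (cl_stem j w)"
| "cl_nf j (KF_of y z w) = KF_of (max j y) z w"
| "cl_nf j Empty_form = Empty_form"

text \<open>A \<open>KF_of\<close> has empty interior, being the closure of the frontier of an open
  or closed set. For the same reason its frontier is just its closure, as used in
  \<open>frontier_nf\<close>.\<close>

fun int_nf :: "nat \<Rightarrow> normal_form \<Rightarrow> normal_form" where
  "int_nf j (Stem w) = Stem (int_stem j w)"
| "int_nf j c = Empty_form"

fun frontier_nf :: "nat \<Rightarrow> normal_form \<Rightarrow> normal_form" where
  "frontier_nf j (Stem w) = frontier_stem j w"
| "frontier_nf j c = cl_nf j c"

lemma normal_forms_simps:
  "Stem w \<in> normal_forms n \<longleftrightarrow> w \<in> stems n"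
  "KF_of y z w \<in> normal_forms n \<longleftrightarrow> 1 \<le> z \<and> z \<le> y \<and> y \<le> n \<and> w \<in> inner_stems n z"
  "Empty_form \<in> normal_forms n"
  unfolding normal_forms_def by force+

lemma normal_forms_closed:
  assumes "j \<in> {1..n}" "c \<in> normal_forms n"
  shows "cl_nf j c \<in> normal_forms n" "int_nf j c \<in> normal_forms n" "frontier_nf j c \<in> normal_forms n"
proof -
  have "cl_nf j c \<in> normal_forms n \<and> int_nf j c \<in> normal_forms n \<and> frontier_nf j c \<in> normal_forms n"
  proof (cases c)
    case (Stem w)
    with assms show ?thesis
      by (cases w) (simp_all add: normal_forms_simps stems_simps inner_stems_simps, auto)
  next
    case (KF_of y z w)
    with assms show ?thesis by (simp add: normal_forms_simps max_def)
  qed (simp add: normal_forms_simps)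
  then show "cl_nf j c \<in> normal_forms n" "int_nf j c \<in> normal_forms n"
    "frontier_nf j c \<in> normal_forms n" by auto
qed

section \<open>Identities for closure, interior and frontier in saturated spaces\<close>

locale saturated_space =
  fixes n :: nat and X :: "'a set" and \<tau> :: "nat \<Rightarrow> 'a topology"
  assumes nonempty_index: "1 \<le> n"
    and n_top: "n_topological_space n X \<tau>"
    and sat: "saturated n \<tau>"
begin

abbreviation k where "k j S \<equiv> \<tau> j closure_of S"
abbreviation i where "i j S \<equiv> \<tau> j interior_of S"
abbreviation f where "f j S \<equiv> k j S - i j S"
abbreviation ev where "ev \<equiv> eval_nf (\<lambda>j. (closure_of) (\<tau> j)) (\<lambda>j. (interior_of) (\<tau> j))"
abbreviation evs where "evs \<equiv> eval_stem (\<lambda>j. (closure_of) (\<tau> j)) (\<lambda>j. (interior_of) (\<tau> j))"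

lemma space: "j \<in> {1..n} \<Longrightarrow> topspace (\<tau> j) = X"
  using n_top by (simp add: n_topological_space_def)

lemma one_index: "1 \<in> {1..n}"
  using nonempty_index by simp

lemma openin_antimono:
  assumes "a \<le> b" "1 \<le> a" "b \<le> n" "openin (\<tau> b) U"
  shows "openin (\<tau> a) U"
  using assms
proof (induction b rule: dec_induct)
  case (step b)
  then have "openin (\<tau> b) U"
    using n_top by (auto simp: n_topological_space_def)
  with step show ?case by simp
qed simp

lemma i_index:
  assumes "a \<le> b" "1 \<le> a" "b \<le> n"
  shows "i b S \<subseteq> i a S"
  using assms by (simp add: interior_of_maximal interior_of_subset openin_antimono)

lemma i_eq: "j \<in> {1..n} \<Longrightarrow> i j S = X - k j (X - S)"
  by (simp add: interior_of_closure_of space)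

lemma k_eq: "j \<in> {1..n} \<Longrightarrow> k j S = X - i j (X - S)"
  by (simp add: closure_of_interior_of space)

lemma compl_k: "j \<in> {1..n} \<Longrightarrow> X - k j S = i j (X - S)"
  using interior_of_subset_topspace[of "\<tau> j"] by (simp add: k_eq space double_diff)

lemma compl_i: "j \<in> {1..n} \<Longrightarrow> X - i j S = k j (X - S)"
  using closure_of_subset_topspace[of "\<tau> j"] by (simp add: i_eq space double_diff)

lemma k_index:
  assumes "a \<le> b" "1 \<le> a" "b \<le> n"
  shows "k a S \<subseteq> k b S"
  using i_index[OF assms, of "X - S"] assms k_eq[of a S] k_eq[of b S] by auto

lemma k_X: "j \<in> {1..n} \<Longrightarrow> k j S \<subseteq> X"
  by (metis closure_of_subset_topspace space)

lemma i_X: "j \<in> {1..n} \<Longrightarrow> i j S \<subseteq> X"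
  by (metis interior_of_subset_topspace space)

lemma k_ge: "j \<in> {1..n} \<Longrightarrow> S \<subseteq> X \<Longrightarrow> S \<subseteq> k j S"
  by (simp add: closure_of_subset space)

text \<open>The coarser topology decides: its open sets are open in the finer one, so the finer
  interior removes nothing from them.\<close>

lemma i_i:
  assumes "a \<in> {1..n}" "b \<in> {1..n}"
  shows "i a (i b S) = i (max a b) S"
proof (cases "a \<le> b")
  case True
  then have "openin (\<tau> a) (i b S)"
    using assms by (intro openin_antimono[of a b]) auto
  then show ?thesis
    using True by (simp add: interior_of_openin max_def)
next
  case False
  have "i a (i b S) \<subseteq> i a S"
    by (simp add: interior_of_mono interior_of_subset)
  moreover have "i a (i a S) \<subseteq> i a (i b S)"
    using False assms by (intro interior_of_mono i_index) auto
  ultimately show ?thesis using False by (simp add: max_def)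
qed

lemma k_k:
  assumes "a \<in> {1..n}" "b \<in> {1..n}"
  shows "k a (k b S) = k (max a b) S"
proof -
  have "max a b \<in> {1..n}" using assms by auto
  moreover have "X - (X - i b (X - S)) = i b (X - S)"
    using i_X[OF assms(2)] by auto
  ultimately show ?thesis
    using assms by (simp add: k_eq i_i)
qed

text \<open>Saturation makes \<open>i\<^sub>n U\<close> dense, in every topology, in every \<open>\<tau>\<^sub>1\<close>-open set \<open>U\<close>.\<close>
lemma k_i:
  assumes "a \<in> {1..n}" "b \<in> {1..n}"
  shows "k a (i b S) = k a (i 1 S)"
proof
  have "i 1 S \<subseteq> k a (i n S)"
  proof
    fix x assume x: "x \<in> i 1 S"
    have "\<exists>y. y \<in> i n S \<and> y \<in> V" if V: "x \<in> V" "openin (\<tau> a) V" for V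
    proof -
      have "openin (\<tau> 1) V"
        using V assms openin_antimono[of 1 a V] by auto
      then have "openin (\<tau> 1) (V \<inter> i 1 S)" by (simp add: openin_Int)
      moreover have "V \<inter> i 1 S \<noteq> {}" using V x by auto
      ultimately have "i n (V \<inter> i 1 S) \<noteq> {}"
        using sat nonempty_index unfolding saturated_def by (meson atLeastAtMost_iff order_refl)
      moreover have "i n (V \<inter> i 1 S) \<subseteq> i n S"
        by (intro interior_of_mono) (use interior_of_subset in fastforce)
      moreover have "i n (V \<inter> i 1 S) \<subseteq> V"
        using interior_of_subset by fastforce
      ultimately show ?thesis by blast
    qed
    then show "x \<in> k a (i n S)"
      using x i_X[OF one_index] assms by (auto simp: in_closure_of space)
  qed
  also have "i n S \<subseteq> i b S"
    using assms by (intro i_index) auto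
  then have "k a (i n S) \<subseteq> k a (i b S)" by (rule closure_of_mono)
  finally have "k a (i 1 S) \<subseteq> k a (k a (i b S))" by (rule closure_of_mono)
  then show "k a (i 1 S) \<subseteq> k a (i b S)" by simp
  show "k a (i b S) \<subseteq> k a (i 1 S)"
    using assms by (intro closure_of_mono i_index) auto
qed

text \<open>Dual to \<open>k_i\<close> under complementation.\<close>

lemma i_k:
  assumes "a \<in> {1..n}" "b \<in> {1..n}"
  shows "i a (k b S) = i a (k 1 S)"
  using k_i[OF assms, of "X - S"] assms one_index
  by (simp only: i_eq[of a "k b S"] i_eq[of a "k 1 S"] compl_k)

text \<open>Kuratowski's \<open>ikik = ik\<close>; all indices but the outermost are first moved to
  1 by \<open>k_i\<close> and \<open>i_k\<close>.\<close>

lemma i_k_i_k: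
  assumes "a \<in> {1..n}" "b \<in> {1..n}" "c \<in> {1..n}"
  shows "i a (k b (i c (k 1 S))) = i a (k 1 S)"
proof
  have "i a (k b (i c (k 1 S))) = i a (k 1 (i 1 (k 1 S)))"
    using assms one_index by (metis i_k k_i)
  also have "\<dots> \<subseteq> i a (k 1 (k 1 S))"
    by (intro interior_of_mono closure_of_mono interior_of_subset)
  finally show "i a (k b (i c (k 1 S))) \<subseteq> i a (k 1 S)" by simp
  have "i a (k 1 S) \<subseteq> i 1 (k 1 S)" using assms by (intro i_index) auto
  also have "\<dots> \<subseteq> k 1 (i 1 (k 1 S))"
    by (intro k_ge one_index i_X)
  finally have "i a (i a (k 1 S)) \<subseteq> i a (k 1 (i 1 (k 1 S)))" by (rule interior_of_mono)
  also have "\<dots> = i a (k b (i c (k 1 S)))"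
    using assms one_index by (metis i_k k_i)
  finally show "i a (k 1 S) \<subseteq> i a (k b (i c (k 1 S)))" by simp
qed

lemma k_i_k_i:
  assumes "a \<in> {1..n}" "b \<in> {1..n}" "c \<in> {1..n}"
  shows "k a (i b (k c (i 1 S))) = k a (i 1 S)"
  using i_k_i_k[OF assms, of "X - S"] assms one_index
  by (simp only: k_eq[of a "i b (k c (i 1 S))"] k_eq[of a "i 1 S"] compl_i compl_k)

lemma f_eq: "j \<in> {1..n} \<Longrightarrow> f j S = k j S \<inter> k j (X - S)"
  using k_X[of j S] by (auto simp: i_eq)

lemma k_f:
  assumes "j \<in> {1..n}"
  shows "k j (f j S) = f j S"
  using assms by (simp add: f_eq closure_of_eq closedin_Int)

text \<open>A frontier is an intersection of two closures; interior distributes over it, and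
  \<open>i_k\<close> removes the index from each closure.\<close>

lemma i_f:
  assumes "a \<in> {1..n}" "x \<in> {1..n}"
  shows "i a (f x S) = i a (f 1 S)"
  using assms one_index by (simp add: f_eq interior_of_Int i_k[of a x])

text \<open>By \<open>i_k\<close> the index of the closure may be changed to that of the frontier,
  which is already closed for it.\<close>

lemma i_k_f:
  assumes "a \<in> {1..n}" "y \<in> {1..n}" "x \<in> {1..n}"
  shows "i a (k y (f x S)) = i a (f 1 S)"
proof -
  have "i a (k y (f x S)) = i a (k x (f x S))" using assms by (metis i_k)
  with assms show ?thesis by (simp only: k_f i_f)
qed

lemma i_k_i_f:
  assumes "a \<in> {1..n}" "b \<in> {1..n}"
  shows "i a (k b (i 1 (f 1 S))) = i a (f 1 S)"
  using i_k_i_k[OF assms one_index, of "f 1 S"] by (simp only: k_f one_index)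

text \<open>The set equals \<open>i a (k 1 W) - k a (i 1 W)\<close>. If \<open>W\<close> is closed
  for some index, it is closed for 1, and \<open>i a W \<subseteq> i 1 W\<close>; if it is open,
  then \<open>i 1 W = W\<close> and \<open>k 1 W \<subseteq> k a W\<close>.\<close>

lemma i_k_f_empty:
  assumes "a \<in> {1..n}" "y \<in> {1..n}" "z \<in> {1..n}" "b \<in> {1..n}" "W = k b S \<or> W = i b S"
  shows "i a (k y (f z W)) = {}"
proof -
  have "i a (k y (f z W)) = i a (k 1 W) - k a (i 1 W)"
  proof -
    have "i a (k y (f z W)) = i a (k 1 W) \<inter> i a (k 1 (X - W))"
      using assms(1-3) one_index by (simp only: i_k_f f_eq[OF one_index] interior_of_Int)
    moreover have "i a (k 1 (X - W)) = X - k a (i 1 W)"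
      using assms(1) one_index by (simp only: compl_i compl_k)
    moreover have "i a (k 1 W) \<subseteq> X" using assms(1) by (rule i_X)
    ultimately show ?thesis by blast
  qed
  also have "\<dots> = {}"
    using assms(5)
  proof
    assume W: "W = k b S"
    have "k 1 (k b S) = k b S" using assms one_index by (simp add: k_k max_def)
    moreover have "i a (k b S) \<subseteq> i 1 (k b S)" using assms by (intro i_index) auto
    ultimately have "i a (k 1 W) \<subseteq> i 1 W" using W by simp
    moreover have "i 1 W \<subseteq> k a (i 1 W)"
      using assms by (intro k_ge i_X one_index)
    ultimately show ?thesis by auto
  next
    assume W: "W = i b S"
    have "i 1 (i b S) = i b S" using assms one_index by (simp add: i_i max_def)
    moreover have "k 1 W \<subseteq> k a W" using assms by (intro k_index) auto
    ultimately show ?thesis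
      using W interior_of_subset[of "\<tau> a" "k 1 W"] by auto
  qed
  finally show ?thesis .
qed

section \<open>Left multiplication of normal forms\<close>

lemma stem_index: "w \<in> inner_stems n z \<Longrightarrow> 1 \<le> z \<Longrightarrow> w \<in> stems n \<and> w \<noteq> Id_stem"
  by (auto simp: inner_stems_def stems_def)

text \<open>Every stem but the identity has open or closed values, so that
  \<open>i_k_f_empty\<close> applies to its frontiers.\<close>

lemma evs_form:
  assumes "w \<in> stems n" "w \<noteq> Id_stem"
  shows "\<exists>b\<in>{1..n}. \<exists>S'. evs w S = k b S' \<or> evs w S = i b S'"
  using assms by (cases w) (auto simp: stems_def)

lemma evs_X:
  assumes "w \<in> stems n" "S \<subseteq> X"
  shows "evs w S \<subseteq> X"
proof (cases "w = Id_stem")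
  case False
  then obtain b S' where "b \<in> {1..n}" "evs w S = k b S' \<or> evs w S = i b S'"
    using evs_form assms by blast
  then show ?thesis using k_X[of b S'] i_X[of b S'] by auto
qed (use assms in simp)

lemma ev_X:
  assumes "c \<in> normal_forms n" "S \<subseteq> X"
  shows "ev c S \<subseteq> X"
proof (cases c)
  case (Stem w)
  then show ?thesis using assms evs_X by (simp add: normal_forms_simps)
next
  case (KF_of y z w)
  then show ?thesis using assms k_X[of y] by (simp add: normal_forms_simps)
qed simp

lemma evs_cl:
  assumes "j \<in> {1..n}" "w \<in> stems n"
  shows "evs (cl_stem j w) S = k j (evs w S)"
proof (cases w)
  case (I_stem a)
  with assms k_i[of j a S] show ?thesis by (simp add: stems_simps)
next
  case (IK_stem a)
  with assms k_i[of j a "k 1 S"] show ?thesis by (simp add: stems_simps)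
next
  case (IKI_stem a)
  with assms k_i_k_i[of j a 1 S] show ?thesis by (auto simp: stems_simps)
next
  case (IF_stem a)
  with assms k_i[of j a "f 1 S"] show ?thesis by (simp add: stems_simps)
qed (use assms in \<open>auto simp: stems_simps k_k\<close>)

lemma evs_int:
  assumes "j \<in> {1..n}" "w \<in> stems n"
  shows "evs (int_stem j w) S = i j (evs w S)"
proof (cases w)
  case (K_stem a)
  with assms i_k[of j a S] show ?thesis by (simp add: stems_simps)
next
  case (KI_stem a)
  with assms i_k[of j a "i 1 S"] show ?thesis by (simp add: stems_simps)
next
  case (KIK_stem a)
  with assms i_k_i_k[of j a 1 S] show ?thesis by (auto simp: stems_simps)
next
  case (KF_stem y x)
  with assms i_k_f[of j y x S] show ?thesis by (auto simp: stems_simps)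
next
  case (KIF_stem a)
  with assms i_k_i_f[of j a S] show ?thesis by (simp add: stems_simps)
qed (use assms in \<open>auto simp: stems_simps i_i\<close>)

lemma evs_frontier:
  assumes j: "j \<in> {1..n}" and w: "w \<in> stems n"
  shows "ev (frontier_stem j w) S = f j (evs w S)"
proof -
  have kf: "k j (f j T) = f j T" for T using j by (rule k_f)
  \<comment> \<open>The outer closure absorbs the inner one, and by \<open>i_k\<close> the interiors
    do not depend on the inner index.\<close>
  have K: "f j (k (max j a) T) = f j (k a T)" if "a \<in> {1..n}" for a T
  proof -
    have "max j a \<in> {1..n}" using j that by auto
    then have "i j (k (max j a) T) = i j (k a T)"
      using i_k[OF j, of "max j a" T] i_k[OF j, of a T] that by (simp only:)
    moreover have "k j (k (max j a) T) = k j (k a T)"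
      using j that \<open>max j a \<in> {1..n}\<close> by (simp add: k_k)
    ultimately show ?thesis by simp
  qed
  have I: "f j (i (max j a) T) = f j (i a T)" if "a \<in> {1..n}" for a T
  proof -
    have "max j a \<in> {1..n}" using j that by auto
    then have "k j (i (max j a) T) = k j (i a T)"
      using k_i[OF j, of "max j a" T] k_i[OF j, of a T] that by (simp only:)
    moreover have "i j (i (max j a) T) = i j (i a T)"
      using j that \<open>max j a \<in> {1..n}\<close> by (simp add: i_i)
    ultimately show ?thesis by simp
  qed
  \<comment> \<open>This trades an outer \<open>i a\<close> with \<open>a \<le> j\<close> for a
    closure; it is used with \<open>T\<close> being \<open>k 1 S\<close> or
    \<open>f 1 S\<close>.\<close>
  have KI: "f j (k j (i 1 T)) = f j (i a T)"
    if "a \<in> {1..n}" "a \<le> j" "i j (k j (i 1 T)) = i j T" for a T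
  proof -
    have "k j (k j (i 1 T)) = k j (i a T)" using j that k_i[of j a T] by simp
    moreover have "i j (i a T) = i j T" using j that by (simp add: i_i max_def)
    ultimately show ?thesis using that by simp
  qed
  show ?thesis
  proof (cases w)
    case (IK_stem a)
    with w have "a \<in> {1..n}" by (simp only: stems_simps)
    moreover have "i j (k j (i 1 (k 1 S))) = i j (k 1 S)"
      using j j one_index by (rule i_k_i_k)
    ultimately show ?thesis using IK_stem KI[of a "k 1 S"] kf by (cases "a \<le> j") simp_all
  next
    case (IKI_stem a)
    with w have a: "a \<in> {1..n}" by (auto simp: stems_simps)
    \<comment> \<open>Here \<open>KI\<close> would give \<open>k j (i 1 (k 1 (i 1 S)))\<close>,
      which still has to be shortened to \<open>k j (i 1 S)\<close> by
      \<open>k_i_k_i\<close>.\<close>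
    have "f j (k j (i 1 S)) = f j (i a (k 1 (i 1 S)))" if "a \<le> j"
    proof -
      have "k j (k j (i 1 S)) = k j (i a (k 1 (i 1 S)))"
        using j a one_index by (simp only: k_i_k_i closure_of_closure_of)
      moreover have "i j (i a (k 1 (i 1 S))) = i j (k j (i 1 S))"
        using j a that i_k[of j j "i 1 S"] by (simp add: i_i max_def)
      ultimately show ?thesis by simp
    qed
    with IKI_stem show ?thesis by (simp add: kf)
  next
    case (IF_stem a)
    with w have "a \<in> {1..n}" by (simp only: stems_simps)
    moreover have "i j (k j (i 1 (f 1 S))) = i j (f 1 S)"
      using j j by (rule i_k_i_f)
    ultimately show ?thesis using IF_stem KI[of a "f 1 S"] kf by (cases "a \<le> j") simp_all
  qed (use w K I in \<open>auto simp: stems_simps kf\<close>)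
qed

lemma ev_closed:
  assumes j: "j \<in> {1..n}" and c: "c \<in> normal_forms n"
  shows "ev (cl_nf j c) S = k j (ev c S)" "ev (int_nf j c) S = i j (ev c S)"
    "ev (frontier_nf j c) S = f j (ev c S)"
proof -
  have "ev (cl_nf j c) S = k j (ev c S) \<and> ev (int_nf j c) S = i j (ev c S) \<and>
    ev (frontier_nf j c) S = f j (ev c S)"
  proof (cases c)
    case (Stem w)
    with c show ?thesis
      using evs_cl[OF j] evs_int[OF j] evs_frontier[OF j] by (simp add: normal_forms_simps)
  next
    case (KF_of y z w)
    with c have y: "y \<in> {1..n}" "z \<in> {1..n}" and w: "w \<in> inner_stems n z"
      by (auto simp: normal_forms_simps)
    then have "w \<in> stems n" "w \<noteq> Id_stem" using stem_index[of w z] by auto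
    then obtain b S' where "b \<in> {1..n}" "evs w S = k b S' \<or> evs w S = i b S'"
      using evs_form by blast
    then have "i j (k y (f z (evs w S))) = {}"
      using i_k_f_empty j y by blast
    with KF_of show ?thesis using k_k[OF j y(1)] by simp
  qed simp
  then show "ev (cl_nf j c) S = k j (ev c S)" "ev (int_nf j c) S = i j (ev c S)"
    "ev (frontier_nf j c) S = f j (ev c S)" by auto
qed

end

section \<open>The generated monoids consist of normal forms\<close>

lemma generated_monoid_extensional:
  assumes "g \<in> generated_monoid X G" "G \<subseteq> extensional (Pow X)"
  shows "g \<in> extensional (Pow X)"
  using assms(1) by induction (use assms(2) in \<open>auto simp: compose_def extensional_def\<close>)

text \<open>Induction shows that every element of the monoid maps \<open>H\<close> into itself by
  left multiplication; applying it to the identity in \<open>H\<close> puts the element itself into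
  \<open>H\<close>.\<close>

lemma generated_monoid_subset:
  assumes H: "H \<subseteq> Pow X \<rightarrow>\<^sub>E Pow X" and one: "(\<lambda>S\<in>Pow X. S) \<in> H"
    and G: "G \<subseteq> extensional (Pow X)"
    and step: "\<And>g h. g \<in> G \<Longrightarrow> h \<in> H \<Longrightarrow> compose (Pow X) g h \<in> H"
  shows "generated_monoid X G \<subseteq> H"
proof
  fix g assume g: "g \<in> generated_monoid X G"
  then have "\<forall>h\<in>H. compose (Pow X) g h \<in> H"
  proof induction
    case one
    have "compose (Pow X) (\<lambda>S\<in>Pow X. S) h = h" if "h \<in> H" for h
      using subsetD[OF H that] by (intro Id_compose) (auto simp: PiE_def)
    then show ?case by (intro ballI) (simp only:)
  next
    case (mult f g)
    have "compose (Pow X) (compose (Pow X) f g) h = compose (Pow X) f (compose (Pow X) g h)"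
      if "h \<in> H" for h
      using subsetD[OF H that] by (intro compose_assoc[symmetric]) (auto simp: PiE_def)
    with mult show ?case by auto
  qed (use step in auto)
  moreover have "compose (Pow X) g (\<lambda>S\<in>Pow X. S) = g"
    using generated_monoid_extensional[OF g G]
    by (intro ext) (auto simp: compose_def extensional_def)
  ultimately show "g \<in> H" using one by metis
qed

lemma generated_monoid_comp:
  assumes "(\<lambda>S\<in>Pow X. g S) \<in> generated_monoid X G" "(\<lambda>S\<in>Pow X. h S) \<in> generated_monoid X G"
    and "\<And>S. S \<subseteq> X \<Longrightarrow> h S \<subseteq> X"
  shows "(\<lambda>S\<in>Pow X. g (h S)) \<in> generated_monoid X G"
proof -
  have "compose (Pow X) (\<lambda>S\<in>Pow X. g S) (\<lambda>S\<in>Pow X. h S) = (\<lambda>S\<in>Pow X. g (h S))"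
    using assms(3) by (auto simp: compose_def intro!: restrict_ext)
  then show ?thesis using generated_monoid.mult[OF assms(1,2)] by simp
qed

context saturated_space
begin

definition nf_op :: "normal_form \<Rightarrow> 'a set \<Rightarrow> 'a set" where
  "nf_op c = (\<lambda>S\<in>Pow X. ev c S)"

definition compl_nf_op :: "normal_form \<Rightarrow> 'a set \<Rightarrow> 'a set" where
  "compl_nf_op c = (\<lambda>S\<in>Pow X. X - ev c S)"

lemma frontier_op_eq: "j \<in> {1..n} \<Longrightarrow> frontier_op X (\<tau> j) = (\<lambda>S\<in>Pow X. f j S)"
  by (simp add: frontier_op_def f_eq fun_eq_iff)

lemma f_X: "j \<in> {1..n} \<Longrightarrow> f j S \<subseteq> X"
  using k_X[of j S] by blast

text \<open>The generating set \<open>G\<close> is arbitrary, so that this covers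
  \<open>KF0\<close>, where interiors are generators, as well as \<open>KF\<close>, where they arise
  as complement, closure, complement.\<close>

lemma nf_op_in:
  assumes "c \<in> normal_forms n"
    and K: "\<And>j. j \<in> {1..n} \<Longrightarrow> closure_op X (\<tau> j) \<in> generated_monoid X G"
    and I: "\<And>j. j \<in> {1..n} \<Longrightarrow> interior_op X (\<tau> j) \<in> generated_monoid X G"
    and F: "\<And>j. j \<in> {1..n} \<Longrightarrow> frontier_op X (\<tau> j) \<in> generated_monoid X G"
  shows "nf_op c \<in> generated_monoid X G"
proof -
  let ?M = "generated_monoid X G"
  have k: "(\<lambda>S\<in>Pow X. k j (h S)) \<in> ?M"
    and i: "(\<lambda>S\<in>Pow X. i j (h S)) \<in> ?M"
    and f: "(\<lambda>S\<in>Pow X. f j (h S)) \<in> ?M"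
    if "j \<in> {1..n}" "(\<lambda>S\<in>Pow X. h S) \<in> ?M" "\<And>S. S \<subseteq> X \<Longrightarrow> h S \<subseteq> X" for j h
    using generated_monoid_comp[OF _ that(2,3)] K[OF that(1)] I[OF that(1)] F[OF that(1)]
    unfolding closure_op_def interior_op_def frontier_op_eq[OF that(1)] by blast+
  have id: "(\<lambda>S\<in>Pow X. S) \<in> ?M" by (rule generated_monoid.one)
  have stem: "(\<lambda>S\<in>Pow X. evs w S) \<in> ?M" if "w \<in> stems n" for w
    using that one_index
    by (cases w; simp only: stems_simps eval_stem.simps; intro k i f id k_X i_X f_X one_index; simp)
  show ?thesis
  proof (cases c)
    case (Stem w)
    with assms(1) stem show ?thesis by (simp add: nf_op_def normal_forms_simps)
  next
    case (KF_of y z w)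
    with assms(1) have y: "y \<in> {1..n}" "z \<in> {1..n}" and w: "w \<in> stems n"
      using stem_index[of w z] by (auto simp: normal_forms_simps)
    have "(\<lambda>S\<in>Pow X. k y (f z (evs w S))) \<in> ?M"
      using y w stem by (intro k f f_X evs_X)
    with KF_of show ?thesis by (simp add: nf_op_def)
  next
    case Empty_form
    \<comment> \<open>The constant empty operator arises as \<open>i f k\<close>: the frontier of a
      closed set has empty interior.\<close>
    have "(\<lambda>S\<in>Pow X. i 1 (k 1 (f 1 (k 1 S)))) \<in> ?M"
      by (intro i k f id one_index k_X f_X)
    moreover have "i 1 (k 1 (f 1 (k 1 S))) = {}" for S
      using i_k_f_empty[OF one_index one_index one_index one_index, of "k 1 S" S] by blast
    ultimately show ?thesis
      using Empty_form by (simp only: nf_op_def eval_nf.simps)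
  qed
qed

lemma nf_op_funcset: "c \<in> normal_forms n \<Longrightarrow> nf_op c \<in> Pow X \<rightarrow>\<^sub>E Pow X"
  using ev_X by (auto simp: nf_op_def)

lemma compl_nf_op_funcset: "compl_nf_op c \<in> Pow X \<rightarrow>\<^sub>E Pow X"
  by (auto simp: compl_nf_op_def)

lemma nf_op_Id: "nf_op (Stem Id_stem) = (\<lambda>S\<in>Pow X. S)"
  by (simp add: nf_op_def)

lemma compose_nf_op:
  assumes "j \<in> {1..n}" "c \<in> normal_forms n"
  shows "compose (Pow X) (closure_op X (\<tau> j)) (nf_op c) = nf_op (cl_nf j c)"
    "compose (Pow X) (interior_op X (\<tau> j)) (nf_op c) = nf_op (int_nf j c)"
    "compose (Pow X) (frontier_op X (\<tau> j)) (nf_op c) = nf_op (frontier_nf j c)"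
  using assms ev_X[OF assms(2)]
  by (auto simp: compose_def nf_op_def closure_op_def interior_op_def frontier_op_eq ev_closed
      simp del: atLeastAtMost_iff intro!: restrict_ext)

text \<open>Closure of a complement is the complement of the interior, while the frontier does not
  see complementation and leads back to a plain normal form.\<close>

lemma compose_compl_nf_op:
  assumes j: "j \<in> {1..n}" and c: "c \<in> normal_forms n"
  shows "compose (Pow X) (closure_op X (\<tau> j)) (compl_nf_op c) = compl_nf_op (int_nf j c)"
    "compose (Pow X) (frontier_op X (\<tau> j)) (compl_nf_op c) = nf_op (frontier_nf j c)"
proof -
  have "f j (X - T) = f j T" if "T \<subseteq> X" for T
    using that j by (simp add: f_eq double_diff Int_commute)
  then show "compose (Pow X) (closure_op X (\<tau> j)) (compl_nf_op c) = compl_nf_op (int_nf j c)"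
    "compose (Pow X) (frontier_op X (\<tau> j)) (compl_nf_op c) = nf_op (frontier_nf j c)"
    using j c ev_X[OF c]
    by (auto simp: compose_def nf_op_def compl_nf_op_def closure_op_def frontier_op_eq ev_closed
        compl_i[symmetric] simp del: atLeastAtMost_iff intro!: restrict_ext)
qed

lemma compose_complement_op:
  assumes "c \<in> normal_forms n"
  shows "compose (Pow X) (complement_op X) (nf_op c) = compl_nf_op c"
    "compose (Pow X) (complement_op X) (compl_nf_op c) = nf_op c"
  using ev_X[OF assms]
  by (auto simp: compose_def nf_op_def compl_nf_op_def complement_op_def double_diff intro!: restrict_ext)

lemma Id_normal_form: "Stem Id_stem \<in> normal_forms n"
  by (simp add: normal_forms_simps stems_simps)

lemma KF0_eq: "KF0 n X \<tau> = nf_op ` normal_forms n"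
proof
  show "KF0 n X \<tau> \<subseteq> nf_op ` normal_forms n"
    unfolding KF0_def
  proof (rule generated_monoid_subset)
    show "(\<lambda>S\<in>Pow X. S) \<in> nf_op ` normal_forms n"
      using nf_op_Id Id_normal_form by (metis imageI)
  next
    fix g h
    assume g: "g \<in> (\<Union>j\<in>{1..n}. {closure_op X (\<tau> j), interior_op X (\<tau> j), frontier_op X (\<tau> j)})"
      and h: "h \<in> nf_op ` normal_forms n"
    from g consider j where "j \<in> {1..n}" "g = closure_op X (\<tau> j)"
      | j where "j \<in> {1..n}" "g = interior_op X (\<tau> j)"
      | j where "j \<in> {1..n}" "g = frontier_op X (\<tau> j)"
      by blast
    then show "compose (Pow X) g h \<in> nf_op ` normal_forms n"
      using h by cases (auto simp: compose_nf_op normal_forms_closed simp del: atLeastAtMost_iff)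
  next
    show "nf_op ` normal_forms n \<subseteq> Pow X \<rightarrow>\<^sub>E Pow X"
      using nf_op_funcset by blast
  qed (auto simp: closure_op_def interior_op_def frontier_op_def)
  show "nf_op ` normal_forms n \<subseteq> KF0 n X \<tau>"
    unfolding KF0_def
    by (intro image_subsetI nf_op_in) (blast intro: generated_monoid.gen)+
qed

lemma KF_eq: "KF n X \<tau> = nf_op ` normal_forms n \<union> compl_nf_op ` normal_forms n"
proof
  let ?G = "(\<Union>j\<in>{1..n}. {closure_op X (\<tau> j), frontier_op X (\<tau> j)}) \<union> {complement_op X}"
  show "KF n X \<tau> \<subseteq> nf_op ` normal_forms n \<union> compl_nf_op ` normal_forms n"
    unfolding KF_def
  proof (rule generated_monoid_subset)
    show "(\<lambda>S\<in>Pow X. S) \<in> nf_op ` normal_forms n \<union> compl_nf_op ` normal_forms n"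
      using nf_op_Id Id_normal_form by (metis UnI1 imageI)
  next
    fix g h
    assume g: "g \<in> ?G" and h: "h \<in> nf_op ` normal_forms n \<union> compl_nf_op ` normal_forms n"
    from g consider j where "j \<in> {1..n}" "g = closure_op X (\<tau> j)"
      | j where "j \<in> {1..n}" "g = frontier_op X (\<tau> j)" | "g = complement_op X"
      by blast
    then show "compose (Pow X) g h \<in> nf_op ` normal_forms n \<union> compl_nf_op ` normal_forms n"
      using h by cases (auto simp: compose_nf_op compose_compl_nf_op compose_complement_op
          normal_forms_closed simp del: atLeastAtMost_iff)
  next
    show "nf_op ` normal_forms n \<union> compl_nf_op ` normal_forms n \<subseteq> Pow X \<rightarrow>\<^sub>E Pow X"
      using nf_op_funcset compl_nf_op_funcset by blast
  qed (auto simp: closure_op_def frontier_op_def complement_op_def)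
  have c: "(\<lambda>S\<in>Pow X. X - S) \<in> generated_monoid X ?G"
    by (rule generated_monoid.gen) (simp add: complement_op_def)
  have k: "closure_op X (\<tau> j) \<in> generated_monoid X ?G" "frontier_op X (\<tau> j) \<in> generated_monoid X ?G"
    if "j \<in> {1..n}" for j
    using that by (auto intro!: generated_monoid.gen)
  have "interior_op X (\<tau> j) \<in> generated_monoid X ?G" if j: "j \<in> {1..n}" for j
  proof -
    have "(\<lambda>S\<in>Pow X. k j (X - S)) \<in> generated_monoid X ?G"
      using k(1)[OF j] c unfolding closure_op_def by (rule generated_monoid_comp) blast
    with c have "(\<lambda>S\<in>Pow X. X - k j (X - S)) \<in> generated_monoid X ?G"
      by (rule generated_monoid_comp) (use k_X[OF j] in blast)
    then show ?thesis by (simp add: interior_op_def i_eq[OF j])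
  qed
  then have nf: "nf_op c \<in> generated_monoid X ?G" if "c \<in> normal_forms n" for c
    using that k by (intro nf_op_in)
  moreover have "compl_nf_op d \<in> generated_monoid X ?G" if "d \<in> normal_forms n" for d
    using c nf[OF that] ev_X[OF that] unfolding nf_op_def compl_nf_op_def
    by (rule generated_monoid_comp)
  ultimately show "nf_op ` normal_forms n \<union> compl_nf_op ` normal_forms n \<subseteq> KF n X \<tau>"
    unfolding KF_def by auto
qed

end

section \<open>The separating model\<close>

text \<open>Each cluster is a pair of points \<open>Top s False\<close>, \<open>Top s True\<close>,
  so that the \<open>Mixed\<close> one can be split by the marked set.\<close>

datatype kind = Out | In | Mixed

text \<open>
  \<open>Low b t p q r\<close> belongs to \<open>A\<close> iff \<open>b\<close>; it always sees the cluster of kind \<open>t\<close>, and sees those of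
  kinds \<open>Out\<close>, \<open>In\<close>, \<open>Mixed\<close> from index \<open>p\<close>, \<open>q\<close>, \<open>r\<close> on. \<open>Deep t l\<close> sees, below index \<open>l\<close>, only
  the cluster of kind \<open>t\<close>, and from \<open>l\<close> on also a point lying in every nonempty \<open>k\<^sub>y f\<^sub>z w\<close>.
\<close>
datatype point =
    Top kind bool
  | Low bool kind nat nat nat
  | Deep kind nat

instance kind :: countable by countable_datatype
instance point :: countable by countable_datatype

fun threshold :: "nat \<Rightarrow> nat \<Rightarrow> nat \<Rightarrow> kind \<Rightarrow> nat" where
  "threshold p q r Out = p"
| "threshold p q r In = q"
| "threshold p q r Mixed = r"

text \<open>\<open>up j x\<close> is the least open set around \<open>x\<close> for the index
  \<open>j\<close>. The point \<open>Low True Out 0 0 0\<close> sees all clusters at every index, so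
  \<open>Deep\<close> must see them too once it sees this point.\<close>

fun up :: "nat \<Rightarrow> point \<Rightarrow> point set" where
  "up j (Top s b) = range (Top s)"
| "up j (Low b t p q r) =
     insert (Low b t p q r) (\<Union>s\<in>{s. s = t \<or> threshold p q r s \<le> j}. range (Top s))"
| "up j (Deep t l) = insert (Deep t l) (range (Top t)) \<union>
     (if l \<le> j then insert (Low True Out 0 0 0) (\<Union>s. range (Top s)) else {})"

fun marked :: "point \<Rightarrow> bool" where
  "marked (Top Out b) \<longleftrightarrow> False"
| "marked (Top In b) \<longleftrightarrow> True"
| "marked (Top Mixed b) \<longleftrightarrow> b"
| "marked (Low b t p q r) \<longleftrightarrow> b"
| "marked (Deep t l) \<longleftrightarrow> False"

text \<open>Closure, and below it interior, in the Alexandrov topology with minimal neighbourhoods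
  \<open>up j x\<close>.\<close>

definition cl :: "nat \<Rightarrow> point set \<Rightarrow> point set" where
  "cl j S = {x. up j x \<inter> S \<noteq> {}}"

definition intr :: "nat \<Rightarrow> point set \<Rightarrow> point set" where
  "intr j S = {x. up j x \<subseteq> S}"

lemma ball_kind: "(\<forall>s. P s) \<longleftrightarrow> P Out \<and> P In \<and> P Mixed"
  by (metis kind.exhaust)

lemma range_Top: "range (Top s) = {Top s False, Top s True}"
  by (auto simp: UNIV_bool)

lemma mem_intr:
  "Top s b \<in> intr j S \<longleftrightarrow> Top s False \<in> S \<and> Top s True \<in> S"
  "Low b t p q r \<in> intr j S \<longleftrightarrow> Low b t p q r \<in> S \<and>
     (t = Out \<or> p \<le> j \<longrightarrow> Top Out False \<in> S \<and> Top Out True \<in> S) \<and>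
     (t = In \<or> q \<le> j \<longrightarrow> Top In False \<in> S \<and> Top In True \<in> S) \<and>
     (t = Mixed \<or> r \<le> j \<longrightarrow> Top Mixed False \<in> S \<and> Top Mixed True \<in> S)"
  "Deep t l \<in> intr j S \<longleftrightarrow> Deep t l \<in> S \<and> Top t False \<in> S \<and> Top t True \<in> S \<and>
     (l \<le> j \<longrightarrow> Low True Out 0 0 0 \<in> intr j S)"
proof -
  show "Top s b \<in> intr j S \<longleftrightarrow> Top s False \<in> S \<and> Top s True \<in> S"
    by (simp add: intr_def range_Top)
  have "Low b t p q r \<in> intr j S \<longleftrightarrow> Low b t p q r \<in> S \<and>
      (\<forall>s. s = t \<or> threshold p q r s \<le> j \<longrightarrow> Top s False \<in> S \<and> Top s True \<in> S)"
    for b t p q r S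
    by (simp add: intr_def range_Top UN_subset_iff)
  then show low: "Low b t p q r \<in> intr j S \<longleftrightarrow> Low b t p q r \<in> S \<and>
     (t = Out \<or> p \<le> j \<longrightarrow> Top Out False \<in> S \<and> Top Out True \<in> S) \<and>
     (t = In \<or> q \<le> j \<longrightarrow> Top In False \<in> S \<and> Top In True \<in> S) \<and>
     (t = Mixed \<or> r \<le> j \<longrightarrow> Top Mixed False \<in> S \<and> Top Mixed True \<in> S)"
    for b t p q r S
    by (simp add: ball_kind eq_commute[of _ t])
  have "Deep t l \<in> intr j S \<longleftrightarrow> Deep t l \<in> S \<and> Top t False \<in> S \<and> Top t True \<in> S \<and>
      (l \<le> j \<longrightarrow> Low True Out 0 0 0 \<in> S \<and> (\<forall>s. Top s False \<in> S \<and> Top s True \<in> S))"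
    by (simp add: intr_def range_Top UN_subset_iff)
  then show "Deep t l \<in> intr j S \<longleftrightarrow> Deep t l \<in> S \<and> Top t False \<in> S \<and> Top t True \<in> S \<and>
     (l \<le> j \<longrightarrow> Low True Out 0 0 0 \<in> intr j S)"
    by (simp add: ball_kind low)
qed

lemma cl_eq: "cl j S = - intr j (- S)"
  by (auto simp: cl_def intr_def)

lemma mem_cl:
  "Top s b \<in> cl j S \<longleftrightarrow> Top s False \<in> S \<or> Top s True \<in> S"
  "Low b t p q r \<in> cl j S \<longleftrightarrow> Low b t p q r \<in> S \<or>
     (t = Out \<or> p \<le> j) \<and> (Top Out False \<in> S \<or> Top Out True \<in> S) \<or>
     (t = In \<or> q \<le> j) \<and> (Top In False \<in> S \<or> Top In True \<in> S) \<or>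
     (t = Mixed \<or> r \<le> j) \<and> (Top Mixed False \<in> S \<or> Top Mixed True \<in> S)"
  "Deep t l \<in> cl j S \<longleftrightarrow> Deep t l \<in> S \<or> Top t False \<in> S \<or> Top t True \<in> S \<or>
     l \<le> j \<and> Low True Out 0 0 0 \<in> cl j S"
  unfolding cl_eq Compl_iff mem_intr by blast+

section \<open>Membership of model points in the values of normal forms\<close>

abbreviation stem_val :: "stem \<Rightarrow> point set" where
  "stem_val w \<equiv> eval_stem cl intr w {x. marked x}"

abbreviation nf_val :: "normal_form \<Rightarrow> point set" where
  "nf_val c \<equiv> eval_nf cl intr c {x. marked x}"

lemma Top_stem_val:
  "Top s b \<in> stem_val Id_stem \<longleftrightarrow> s = In \<or> s = Mixed \<and> b"
  "Top s b \<in> stem_val (K_stem a) \<longleftrightarrow> s = In \<or> s = Mixed"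
  "Top s b \<in> stem_val (I_stem a) \<longleftrightarrow> s = In"
  "Top s b \<in> stem_val (KI_stem a) \<longleftrightarrow> s = In"
  "Top s b \<in> stem_val (IK_stem a) \<longleftrightarrow> s = In \<or> s = Mixed"
  "Top s b \<in> stem_val (KIK_stem a) \<longleftrightarrow> s = In \<or> s = Mixed"
  "Top s b \<in> stem_val (IKI_stem a) \<longleftrightarrow> s = In"
  "Top s b \<in> stem_val (KF_stem y x) \<longleftrightarrow> s = Mixed"
  "Top s b \<in> stem_val (IF_stem a) \<longleftrightarrow> s = Mixed"
  "Top s b \<in> stem_val (KIF_stem a) \<longleftrightarrow> s = Mixed"
  by (cases s; simp add: mem_cl mem_intr)+

context
  fixes b :: bool and t :: kind and p q r :: nat
begin

private abbreviation low where "low \<equiv> Low b t p q r"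
text \<open>These three say which kinds of cluster the low point sees at index
  \<open>j\<close>.\<close>

private abbreviation out where "out j \<equiv> t = Out \<or> p \<le> j"
private abbreviation inn where "inn j \<equiv> t = In \<or> q \<le> j"
private abbreviation mix where "mix j \<equiv> t = Mixed \<or> r \<le> j"

text \<open>A low point sees its own kind \<open>t\<close> at every index. Hence
  \<open>\<not> out a\<close> alone suffices for \<open>IK_stem a\<close>: the point then sees
  \<open>In\<close> or \<open>Mixed\<close> already at index 1.\<close>

lemma Low_stem_val:
  assumes "1 \<le> a" "1 \<le> a'" "a \<le> a'"
  shows
  "low \<in> stem_val Id_stem \<longleftrightarrow> b"
  "low \<in> stem_val (K_stem a) \<longleftrightarrow> b \<or> inn a \<or> mix a"
  "low \<in> stem_val (I_stem a) \<longleftrightarrow> b \<and> \<not> out a \<and> \<not> mix a"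
  "low \<in> stem_val (KI_stem a) \<longleftrightarrow> inn a"
  "low \<in> stem_val (IK_stem a) \<longleftrightarrow> \<not> out a"
  "low \<in> stem_val (KIK_stem a) \<longleftrightarrow> inn a \<or> mix a"
  "low \<in> stem_val (IKI_stem a) \<longleftrightarrow> \<not> out a \<and> \<not> mix a"
  "low \<in> stem_val (KF_stem a' a) \<longleftrightarrow> (b \<or> inn a) \<and> (\<not> b \<or> out a) \<or> mix a'"
  "low \<in> stem_val (IF_stem a) \<longleftrightarrow> \<not> out a \<and> \<not> inn a"
  "low \<in> stem_val (KIF_stem a) \<longleftrightarrow> mix a"
  using assms by (cases t; cases b; simp add: mem_cl mem_intr Top_stem_val; linarith?)+

text \<open>No right-hand side mentions \<open>y\<close>: the inner frontier contains no top point,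
  so the outer closure adds no low point. Recovering \<open>y\<close> is left to the
  \<open>Deep\<close> points.\<close>

lemma Low_KF_of:
  assumes "1 \<le> z" "z \<le> y" "z \<le> a" "1 \<le> a'" "a' \<le> a"
  shows
  "low \<in> nf_val (KF_of y z (K_stem a)) \<longleftrightarrow> (b \<or> inn a \<or> mix a) \<and> out z"
  "low \<in> nf_val (KF_of y z (I_stem a)) \<longleftrightarrow> inn z \<and> (\<not> b \<or> out a \<or> mix a)"
  "low \<in> nf_val (KF_of y z (KI_stem a)) \<longleftrightarrow> inn a \<and> (out z \<or> mix z)"
  "low \<in> nf_val (KF_of y z (IKI_stem a)) \<longleftrightarrow> inn z \<and> (out a \<or> mix a)"
  "low \<in> nf_val (KF_of y z (KIK_stem a)) \<longleftrightarrow> (inn a \<or> mix a) \<and> out z"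
  "low \<in> nf_val (KF_of y z (IK_stem a)) \<longleftrightarrow> (inn z \<or> mix z) \<and> out a"
  "low \<in> nf_val (KF_of y z (KF_stem a a')) \<longleftrightarrow>
     ((b \<or> inn a') \<and> (\<not> b \<or> out a') \<or> mix a) \<and> (out z \<or> inn z)"
  "low \<in> nf_val (KF_of y z (KIF_stem a)) \<longleftrightarrow> mix a \<and> (out z \<or> inn z)"
  "low \<in> nf_val (KF_of y z (IF_stem a)) \<longleftrightarrow> mix z \<and> (out a \<or> inn a)"
  using assms
  unfolding eval_nf.simps mem_cl mem_intr Diff_iff Top_stem_val
    Low_stem_val[OF order_trans[OF assms(1,3)] order_trans[OF assms(1,3)] order_refl]
    Low_stem_val[OF assms(4) order_trans[OF assms(1,3)] assms(5)]
  by (cases t; cases b; simp; linarith?)+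

end

text \<open>
  The cluster seen by \<open>Deep\<close> is chosen so that \<open>Deep\<close> is not itself in the frontier \<open>f\<^sub>z w\<close>;
  its membership in \<open>k\<^sub>y f\<^sub>z w\<close> then depends only on \<open>y\<close>.
\<close>
fun probe_kind :: "stem \<Rightarrow> kind" where
  "probe_kind (K_stem a) = In"
| "probe_kind (KI_stem a) = In"
| "probe_kind (KIK_stem a) = In"
| "probe_kind (KF_stem a x) = Mixed"
| "probe_kind (KIF_stem a) = Mixed"
| "probe_kind w = Out"

lemma inner_stem_cases:
  assumes "w \<in> inner_stems n z"
  obtains a where "w \<in> {K_stem a, I_stem a, KI_stem a, KIK_stem a, KIF_stem a}" "z \<le> a" "a \<le> n"
  | a where "w \<in> {IKI_stem a, IK_stem a, IF_stem a}" "z < a" "a \<le> n"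
  | a x where "w = KF_stem a x" "z \<le> a" "a \<le> n" "1 \<le> x" "x \<le> a"
  using assms by (auto simp: inner_stems_def)

lemma Top_KF_of:
  assumes "w \<in> inner_stems n z"
  shows "Top s b \<notin> nf_val (KF_of y z w)"
  using assms
  by (cases rule: inner_stem_cases) (auto simp: mem_cl mem_intr Top_stem_val)

lemma Deep_KF_of:
  assumes "w \<in> inner_stems n z" "1 \<le> z" "z \<le> y"
  shows "Deep (probe_kind w) l \<in> nf_val (KF_of y z w) \<longleftrightarrow> l \<le> y"
proof -
  let ?q = "Low True Out 0 0 0"
  have q: "?q \<in> nf_val (KF_of y z w)"
    using assms(1)
    by (cases rule: inner_stem_cases) (use assms in \<open>auto simp: Low_KF_of simp del: eval_nf.simps\<close>)
  \<comment> \<open>As \<open>z \<le> y < l\<close>, the point sees only itself and its cluster at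
    index \<open>z\<close>. It lies in the interior when the probe is \<open>In\<close> or
    \<open>Mixed\<close>, and outside the closure when the probe is \<open>Out\<close>.\<close>
  have "Deep (probe_kind w) l \<notin> cl z (stem_val w) - intr z (stem_val w)" if "\<not> l \<le> y"
    using assms(1)
    by (cases rule: inner_stem_cases)
      (use assms that in \<open>auto simp: mem_cl mem_intr Top_stem_val simp del: eval_stem.simps, (auto simp: mem_cl mem_intr)?\<close>)
  then show ?thesis
    using q Top_KF_of[OF assms(1)] by (auto simp: mem_cl)
qed

section \<open>Recovering a normal form from its value\<close>

text \<open>The level \<open>a\<close> is read off from a family of points whose \<open>j\<close>-th member lies in the set
  exactly when \<open>j \<le> a\<close>.\<close>
definition level :: "nat \<Rightarrow> (nat \<Rightarrow> point) \<Rightarrow> point set \<Rightarrow> nat" where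
  "level n g S = card ({1..n} \<inter> {j. g j \<in> S})"

lemma level_eq:
  assumes "\<And>j. 1 \<le> j \<Longrightarrow> j \<le> n \<Longrightarrow> g j \<in> S \<longleftrightarrow> j \<le> a" "a \<le> n"
  shows "level n g S = a"
proof -
  have "{1..n} \<inter> {j. g j \<in> S} = {1..a}" using assms by auto
  then show ?thesis by (simp add: level_def)
qed

text \<open>The index \<open>Suc n\<close> stands for ``never'', as only the topologies \<open>1, \<dots>, n\<close> are used.\<close>
definition decode_stem :: "nat \<Rightarrow> point set \<Rightarrow> stem" where
  "decode_stem n S =
    (let e = Suc n in
     if Top Mixed True \<in> S then
       if Top Mixed False \<notin> S then Id_stem
       else if Top In True \<in> S then
         if Low True Out e e e \<in> S then K_stem (level n (\<lambda>j. Low False Out e j e) S)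
         else if Low True Out e 1 e \<in> S then KIK_stem (level n (\<lambda>j. Low False Out e j e) S)
         else IK_stem (level n (\<lambda>j. Low True In j e e) (- S))
       else
         if Low True Out e e e \<in> S
         then KF_stem (level n (\<lambda>j. Low False Out e e j) S) (level n (\<lambda>j. Low True In j e e) S)
         else if Low True Out e e 1 \<in> S then KIF_stem (level n (\<lambda>j. Low False Out e e j) S)
         else IF_stem (level n (\<lambda>j. Low True Mixed j e e) (- S))
     else
       if Low False In e e e \<notin> S then I_stem (level n (\<lambda>j. Low True In j e e) (- S))
       else if Low False In 1 e e \<in> S then KI_stem (level n (\<lambda>j. Low False Out e j e) S)
       else IKI_stem (level n (\<lambda>j. Low False In j e e) (- S)))"

text \<open>Some families, such as \<open>KI_stem\<close> and \<open>IKI_stem\<close>, pass the same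
  membership tests and are told apart by comparing two levels: with closure outermost the inner
  index is read by \<open>u\<close> and is at least \<open>z\<close>; with interior outermost it is
  read by \<open>v\<close> and exceeds \<open>z\<close>. The strict bounds in
  \<open>inner_stems\<close> make this decisive.\<close>

definition decode_KF_of :: "nat \<Rightarrow> point set \<Rightarrow> nat \<times> stem" where
  "decode_KF_of n S =
    (let e = Suc n;
       u = level n (\<lambda>j. Low False Out e j e) S;
       v = level n (\<lambda>j. Low False In j e e) S;
       u' = level n (\<lambda>j. Low False Out e e j) S;
       v' = level n (\<lambda>j. Low False Mixed j e e) S;
       w = level n (\<lambda>j. Low True In j e e) S
     in
     if Low True Out e e e \<in> S then
       if Low False In e e e \<in> S then (v', KF_stem u' w) else (w, K_stem u)
     else if Low False In e e e \<in> S then (u, I_stem w)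
     else if Low False In 1 e e \<in> S then
       if Low False In e e 1 \<in> S
       then if v \<le> u then (v, KI_stem u) else (u, IKI_stem v)
       else if v \<le> u then (v, KIK_stem u) else (u, IK_stem v)
     else if v' \<le> u' then (v', KIF_stem u') else (u', IF_stem v'))"

text \<open>Stems are recognised by a top point in \<open>In\<close> or \<open>Mixed\<close>, and
  \<open>Low True Out 0 0 0\<close> lies in every \<open>KF_of\<close>. The outer index comes last,
  because its probe depends on the stem already found.\<close>

definition decode :: "nat \<Rightarrow> point set \<Rightarrow> normal_form" where
  "decode n S =
    (if Top In True \<in> S \<or> Top Mixed True \<in> S then Stem (decode_stem n S)
     else if Low True Out 0 0 0 \<notin> S then Empty_form
     else let (z, w) = decode_KF_of n S in KF_of (level n (Deep (probe_kind w)) S) z w)"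

lemma level_Compl_eq:
  assumes "\<And>j. 1 \<le> j \<Longrightarrow> j \<le> n \<Longrightarrow> g j \<in> S \<longleftrightarrow> \<not> j \<le> a" "a \<le> n"
  shows "level n g (- S) = a"
  using assms by (intro level_eq) auto

lemma decode_stem_eq:
  assumes "w \<in> stems n"
  shows "decode_stem n (stem_val w) = w"
proof -
  note [simp del] = eval_stem.simps
  note defs = decode_stem_def Let_def Top_stem_val
  show ?thesis
  proof (cases w)
    case Id_stem
    then show ?thesis by (simp add: defs)
  next
    case (K_stem a)
    with assms have a: "1 \<le> a" "a \<le> n" by (auto simp: stems_def)
    then have "level n (\<lambda>j. Low False Out (Suc n) j (Suc n)) (stem_val (K_stem a)) = a"
      by (intro level_eq) (simp_all add: Low_stem_val)
    with a K_stem show ?thesis by (simp add: defs Low_stem_val)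
  next
    case (I_stem a)
    with assms have a: "1 \<le> a" "a \<le> n" by (auto simp: stems_def)
    then have "level n (\<lambda>j. Low True In j (Suc n) (Suc n)) (- stem_val (I_stem a)) = a"
      by (intro level_Compl_eq) (simp_all add: Low_stem_val)
    with a I_stem show ?thesis by (simp add: defs Low_stem_val)
  next
    case (KI_stem a)
    with assms have a: "1 \<le> a" "a \<le> n" by (auto simp: stems_def)
    then have "level n (\<lambda>j. Low False Out (Suc n) j (Suc n)) (stem_val (KI_stem a)) = a"
      by (intro level_eq) (simp_all add: Low_stem_val)
    with a KI_stem show ?thesis by (simp add: defs Low_stem_val)
  next
    case (IK_stem a)
    with assms have a: "1 \<le> a" "a \<le> n" by (auto simp: stems_def)
    then have "level n (\<lambda>j. Low True In j (Suc n) (Suc n)) (- stem_val (IK_stem a)) = a"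
      by (intro level_Compl_eq) (simp_all add: Low_stem_val)
    with a IK_stem show ?thesis by (simp add: defs Low_stem_val)
  next
    case (KIK_stem a)
    with assms have a: "1 \<le> a" "a \<le> n" by (auto simp: stems_def)
    then have "level n (\<lambda>j. Low False Out (Suc n) j (Suc n)) (stem_val (KIK_stem a)) = a"
      by (intro level_eq) (simp_all add: Low_stem_val)
    with a KIK_stem show ?thesis by (simp add: defs Low_stem_val)
  next
    case (IKI_stem a)
    with assms have a: "1 \<le> a" "a \<le> n" by (auto simp: stems_def)
    then have "level n (\<lambda>j. Low False In j (Suc n) (Suc n)) (- stem_val (IKI_stem a)) = a"
      by (intro level_Compl_eq) (simp_all add: Low_stem_val)
    with a IKI_stem show ?thesis by (simp add: defs Low_stem_val)
  next
    case (IF_stem a)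
    with assms have a: "1 \<le> a" "a \<le> n" by (auto simp: stems_def)
    then have "level n (\<lambda>j. Low True Mixed j (Suc n) (Suc n)) (- stem_val (IF_stem a)) = a"
      by (intro level_Compl_eq) (simp_all add: Low_stem_val)
    with a IF_stem show ?thesis by (simp add: defs Low_stem_val)
  next
    case (KIF_stem a)
    with assms have a: "1 \<le> a" "a \<le> n" by (auto simp: stems_def)
    then have "level n (\<lambda>j. Low False Out (Suc n) (Suc n) j) (stem_val (KIF_stem a)) = a"
      by (intro level_eq) (simp_all add: Low_stem_val)
    with a KIF_stem show ?thesis by (simp add: defs Low_stem_val)
  next
    case (KF_stem y x)
    with assms have a: "1 \<le> x" "x \<le> y" "y \<le> n" by (auto simp: stems_def)
    then have "level n (\<lambda>j. Low False Out (Suc n) (Suc n) j) (stem_val (KF_stem y x)) = y"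
      "level n (\<lambda>j. Low True In j (Suc n) (Suc n)) (stem_val (KF_stem y x)) = x"
      by (intro level_eq; simp add: Low_stem_val)+
    with a KF_stem show ?thesis by (simp add: defs Low_stem_val)
  qed
qed

lemma decode_KF_of_eq:
  assumes "w \<in> inner_stems n z" "1 \<le> z" "z \<le> y"
  shows "decode_KF_of n (nf_val (KF_of y z w)) = (z, w)"
proof -
  note [simp del] = eval_nf.simps
  note defs = decode_KF_of_def Let_def
  show ?thesis
  proof (cases w)
    case Id_stem
    with assms show ?thesis by (auto simp: inner_stems_def)
  next
    case (K_stem a)
    with assms have a: "1 \<le> z" "z \<le> y" "z \<le> a" "a \<le> n" by (auto simp: inner_stems_def)
    then have "level n (\<lambda>j. Low True In j (Suc n) (Suc n)) (nf_val (KF_of y z (K_stem a))) = z"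
      "level n (\<lambda>j. Low False Out (Suc n) j (Suc n)) (nf_val (KF_of y z (K_stem a))) = a"
      by (intro level_eq; simp add: Low_KF_of)+
    with a K_stem show ?thesis by (simp add: defs Low_KF_of)
  next
    case (I_stem a)
    with assms have a: "1 \<le> z" "z \<le> y" "z \<le> a" "a \<le> n" by (auto simp: inner_stems_def)
    then have "level n (\<lambda>j. Low False Out (Suc n) j (Suc n)) (nf_val (KF_of y z (I_stem a))) = z"
      "level n (\<lambda>j. Low True In j (Suc n) (Suc n)) (nf_val (KF_of y z (I_stem a))) = a"
      by (intro level_eq; simp add: Low_KF_of)+
    with a I_stem show ?thesis by (simp add: defs Low_KF_of)
  next
    case (KI_stem a)
    with assms have a: "1 \<le> z" "z \<le> y" "z \<le> a" "a \<le> n" by (auto simp: inner_stems_def)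
    then have "level n (\<lambda>j. Low False Out (Suc n) j (Suc n)) (nf_val (KF_of y z (KI_stem a))) = a"
      "level n (\<lambda>j. Low False In j (Suc n) (Suc n)) (nf_val (KF_of y z (KI_stem a))) = z"
      by (intro level_eq; simp add: Low_KF_of)+
    with a KI_stem show ?thesis by (simp add: defs Low_KF_of)
  next
    case (KIK_stem a)
    with assms have a: "1 \<le> z" "z \<le> y" "z \<le> a" "a \<le> n" by (auto simp: inner_stems_def)
    then have "level n (\<lambda>j. Low False Out (Suc n) j (Suc n)) (nf_val (KF_of y z (KIK_stem a))) = a"
      "level n (\<lambda>j. Low False In j (Suc n) (Suc n)) (nf_val (KF_of y z (KIK_stem a))) = z"
      by (intro level_eq; simp add: Low_KF_of)+
    with a KIK_stem show ?thesis by (simp add: defs Low_KF_of)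
  next
    case (KIF_stem a)
    with assms have a: "1 \<le> z" "z \<le> y" "z \<le> a" "a \<le> n" by (auto simp: inner_stems_def)
    then have "level n (\<lambda>j. Low False Out (Suc n) (Suc n) j) (nf_val (KF_of y z (KIF_stem a))) = a"
      "level n (\<lambda>j. Low False Mixed j (Suc n) (Suc n)) (nf_val (KF_of y z (KIF_stem a))) = z"
      by (intro level_eq; simp add: Low_KF_of)+
    with a KIF_stem show ?thesis by (simp add: defs Low_KF_of)
  next
    case (IKI_stem a)
    with assms have a: "1 \<le> z" "z \<le> y" "z < a" "a \<le> n" by (auto simp: inner_stems_def)
    then have "level n (\<lambda>j. Low False Out (Suc n) j (Suc n)) (nf_val (KF_of y z (IKI_stem a))) = z"
      "level n (\<lambda>j. Low False In j (Suc n) (Suc n)) (nf_val (KF_of y z (IKI_stem a))) = a"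
      by (intro level_eq; simp add: Low_KF_of)+
    with a IKI_stem show ?thesis by (simp add: defs Low_KF_of)
  next
    case (IK_stem a)
    with assms have a: "1 \<le> z" "z \<le> y" "z < a" "a \<le> n" by (auto simp: inner_stems_def)
    then have "level n (\<lambda>j. Low False Out (Suc n) j (Suc n)) (nf_val (KF_of y z (IK_stem a))) = z"
      "level n (\<lambda>j. Low False In j (Suc n) (Suc n)) (nf_val (KF_of y z (IK_stem a))) = a"
      by (intro level_eq; simp add: Low_KF_of)+
    with a IK_stem show ?thesis by (simp add: defs Low_KF_of)
  next
    case (IF_stem a)
    with assms have a: "1 \<le> z" "z \<le> y" "z < a" "a \<le> n" by (auto simp: inner_stems_def)
    then have "level n (\<lambda>j. Low False Out (Suc n) (Suc n) j) (nf_val (KF_of y z (IF_stem a))) = z"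
      "level n (\<lambda>j. Low False Mixed j (Suc n) (Suc n)) (nf_val (KF_of y z (IF_stem a))) = a"
      by (intro level_eq; simp add: Low_KF_of)+
    with a IF_stem show ?thesis by (simp add: defs Low_KF_of)
  next
    case (KF_stem a x)
    with assms have a: "1 \<le> z" "z \<le> y" "z \<le> a" "a \<le> n" "1 \<le> x" "x \<le> a"
      by (auto simp: inner_stems_def)
    then have "level n (\<lambda>j. Low False Out (Suc n) (Suc n) j) (nf_val (KF_of y z (KF_stem a x))) = a"
      "level n (\<lambda>j. Low True In j (Suc n) (Suc n)) (nf_val (KF_of y z (KF_stem a x))) = x"
      "level n (\<lambda>j. Low False Mixed j (Suc n) (Suc n)) (nf_val (KF_of y z (KF_stem a x))) = z"
      by (intro level_eq; simp add: Low_KF_of)+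
    with a KF_stem show ?thesis by (simp add: defs Low_KF_of)
  qed
qed

lemma decode_eq:
  assumes "c \<in> normal_forms n"
  shows "decode n (nf_val c) = c"
proof -
  consider "c = Empty_form" | w where "c = Stem w" "w \<in> stems n"
    | y z w where "c = KF_of y z w" "1 \<le> z" "z \<le> y" "y \<le> n" "w \<in> inner_stems n z"
    using assms by (auto simp: normal_forms_def)
  then show ?thesis
  proof cases
    case 1
    then show ?thesis by (simp add: decode_def)
  next
    case 2
    then have "Top In True \<in> stem_val w \<or> Top Mixed True \<in> stem_val w"
      by (cases w) (auto simp: Top_stem_val simp del: eval_stem.simps)
    with 2 show ?thesis by (simp add: decode_def decode_stem_eq)
  next
    case (3 y z w)
    have "Low True Out 0 0 0 \<in> nf_val (KF_of y z w)"
      using 3(5)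
      by (cases rule: inner_stem_cases) (use 3 in \<open>auto simp: Low_KF_of simp del: eval_nf.simps\<close>)
    moreover have "level n (Deep (probe_kind w)) (nf_val (KF_of y z w)) = y"
      using 3 by (intro level_eq) (auto simp: Deep_KF_of simp del: eval_nf.simps)
    ultimately show ?thesis
      using 3 by (simp add: decode_def Top_KF_of decode_KF_of_eq del: eval_nf.simps)
  qed
qed

lemma inj_on_nf_val: "inj_on nf_val (normal_forms n)"
  using decode_eq by (metis inj_on_inverseI)

text \<open>These points lie in every complement of a normal form value, so no such complement is
  itself a normal form value.\<close>

lemma Top_Out_nf_val:
  assumes "c \<in> normal_forms n"
  shows "Top Out b \<notin> nf_val c"
proof -
  have "Top Out b \<notin> stem_val w" for w
    by (cases w) (auto simp: Top_stem_val simp del: eval_stem.simps)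
  then show ?thesis
    using assms Top_KF_of by (auto simp: normal_forms_def simp del: eval_nf.simps(2))
qed

section \<open>The model as a saturated space\<close>

lemma up_refl: "x \<in> up j x"
  by (cases x) auto

lemma up_trans: "y \<in> up j x \<Longrightarrow> up j y \<subseteq> up j x"
  by (cases x) (auto simp: range_Top split: if_splits)

lemma up_mono: "j \<le> j' \<Longrightarrow> up j x \<subseteq> up j' x"
  by (cases x) (auto simp: range_Top dest: order_trans)

lemma up_top: "\<exists>s. range (Top s) \<subseteq> up j x"
  by (cases x) auto

text \<open>The model is carried along an injection, since its points form a datatype while the
  space sought is a set of reals.\<close>

context
  fixes e :: "point \<Rightarrow> 'a"
  assumes inj: "inj e"
begin

definition model_topology :: "nat \<Rightarrow> 'a topology" where
  "model_topology j = topology (\<lambda>U. U \<subseteq> range e \<and> (\<forall>x. e x \<in> U \<longrightarrow> e ` up j x \<subseteq> U))"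

lemma openin_model:
  "openin (model_topology j) U \<longleftrightarrow> U \<subseteq> range e \<and> (\<forall>x. e x \<in> U \<longrightarrow> e ` up j x \<subseteq> U)"
proof -
  have "istopology (\<lambda>U. U \<subseteq> range e \<and> (\<forall>x. e x \<in> U \<longrightarrow> e ` up j x \<subseteq> U))"
    unfolding istopology_def by blast
  then show ?thesis by (simp add: model_topology_def)
qed

lemma topspace_model: "topspace (model_topology j) = range e"
  unfolding topspace_def openin_model by blast

lemma interior_model: "model_topology j interior_of (e ` S) = e ` intr j S"
proof
  show "model_topology j interior_of (e ` S) \<subseteq> e ` intr j S"
  proof
    fix y assume "y \<in> model_topology j interior_of (e ` S)"
    then obtain U where U: "openin (model_topology j) U" "y \<in> U" "U \<subseteq> e ` S"
      by (auto simp: interior_of_def)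
    then obtain x where x: "y = e x" by (auto simp: openin_model)
    with U have "e ` up j x \<subseteq> e ` S" unfolding openin_model by blast
    then have "up j x \<subseteq> S" using inj by (simp add: inj_image_subset_iff)
    with x show "y \<in> e ` intr j S" by (simp add: intr_def)
  qed
  have "up j y \<subseteq> S" if "x \<in> intr j S" "y \<in> up j x" for x y
    using that up_trans by (fastforce simp: intr_def)
  then have "openin (model_topology j) (e ` intr j S)"
    using inj by (auto simp: openin_model inj_image_mem_iff intr_def)
  moreover have "e ` intr j S \<subseteq> e ` S"
    using up_refl by (auto simp: intr_def)
  ultimately show "e ` intr j S \<subseteq> model_topology j interior_of (e ` S)"
    by (simp add: interior_of_maximal)
qed

lemma closure_model: "model_topology j closure_of (e ` S) = e ` cl j S"
proof -
  have c: "range e - e ` T = e ` (- T)" for T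
    using inj by (simp add: Compl_eq_Diff_UNIV image_set_diff)
  show ?thesis
    by (simp add: closure_of_interior_of topspace_model c interior_model cl_eq)
qed

lemma eval_stem_model:
  "eval_stem (\<lambda>j. (closure_of) (model_topology j)) (\<lambda>j. (interior_of) (model_topology j)) w (e ` S) =
   e ` eval_stem cl intr w S"
  by (cases w) (simp_all add: closure_model interior_model flip: image_set_diff[OF inj])

lemma eval_nf_model:
  "eval_nf (\<lambda>j. (closure_of) (model_topology j)) (\<lambda>j. (interior_of) (model_topology j)) c (e ` S) =
   e ` eval_nf cl intr c S"
  by (cases c) (simp_all add: eval_stem_model closure_model interior_model flip: image_set_diff[OF inj])

lemma saturated_space_model:
  assumes "1 \<le> n"
  shows "saturated_space n (range e) model_topology"
proof
  show "n_topological_space n (range e) model_topology"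
    unfolding n_topological_space_def
  proof (intro conjI ballI)
    fix j
    have "openin (model_topology j) U" if "openin (model_topology (Suc j)) U" for U
      using that up_mono[of j "Suc j"] unfolding openin_model by fastforce
    then show "{U. openin (model_topology (Suc j)) U} \<subseteq> {U. openin (model_topology j) U}" by blast
  qed (rule topspace_model)
  show "saturated n model_topology"
    unfolding saturated_def
  proof (intro ballI allI impI)
    fix x y U assume U: "openin (model_topology x) U \<and> U \<noteq> {}"
    then obtain p where p: "e p \<in> U" unfolding openin_model by blast
    obtain s where s: "range (Top s) \<subseteq> up x p" using up_top by blast
    have "e ` range (Top s) \<subseteq> e ` up x p" using s by (rule image_mono)
    also have "\<dots> \<subseteq> U" using U p by (auto simp: openin_model)
    finally have "e ` range (Top s) \<subseteq> U" .
    \<comment> \<open>For a point of a cluster, \<open>up y\<close> is the cluster itself whatever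
      \<open>y\<close> is, so clusters are open at every index.\<close>
    moreover have "openin (model_topology y) (e ` range (Top s))"
      using inj by (auto simp: openin_model inj_image_mem_iff)
    ultimately show "model_topology y interior_of U \<noteq> {}"
      using interior_of_maximal[of "e ` range (Top s)" U "model_topology y"] by auto
  qed
qed (rule assms)

end

section \<open>Cardinalities of the monoids and of the orbit\<close>

theorem theorem1p2:
  fixes n :: nat
  assumes "n \<ge> 1"
  shows "\<exists>(X :: real set) (\<tau> :: nat \<Rightarrow> real topology).
    n_topological_space n X \<tau> \<and> saturated n \<tau> \<and>
    real (card (KF0 n X \<tau>)) = kf_poly n \<and>
    real (card (KF n X \<tau>)) = 2 * kf_poly n \<and>
    (\<exists>A\<subseteq>X. real (card {h A | h. h \<in> KF n X \<tau>}) = 2 * kf_poly n)"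
proof -
  \<comment> \<open>The points form a countable type and so embed into the reals through the
    naturals.\<close>
  define e :: "point \<Rightarrow> real" where "e = real \<circ> to_nat"
  have inj: "inj e" by (simp add: e_def inj_def)
  let ?X = "range e" and ?\<tau> = "model_topology e" and ?A = "e ` {x. marked x}"
  interpret saturated_space n ?X ?\<tau>
    using inj assms by (rule saturated_space_model)
  have A: "?A \<subseteq> ?X" by blast
  have nf: "nf_op c ?A = e ` nf_val c" and conf: "compl_nf_op c ?A = e ` (- nf_val c)" for c
    using A by (simp_all add: nf_op_def compl_nf_op_def eval_nf_model[OF inj] Compl_eq_Diff_UNIV
        image_set_diff[OF inj])
  have N: "real (card (normal_forms n)) = kf_poly n" by (rule card_normal_forms)
  have inj1: "inj_on (\<lambda>c. nf_op c ?A) (normal_forms n)"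
    using inj_on_nf_val inj by (auto simp: nf inj_on_def inj_image_eq_iff)
  have inj2: "inj_on (\<lambda>c. compl_nf_op c ?A) (normal_forms n)"
    using inj_on_nf_val inj by (auto simp: conf inj_on_def inj_image_eq_iff)
  have disj: "(\<lambda>c. nf_op c ?A) ` normal_forms n \<inter> (\<lambda>c. compl_nf_op c ?A) ` normal_forms n = {}"
  proof -
    have "nf_op c ?A \<noteq> compl_nf_op d ?A" if "c \<in> normal_forms n" "d \<in> normal_forms n" for c d
    proof
      assume "nf_op c ?A = compl_nf_op d ?A"
      then have "nf_val c = - nf_val d" using inj by (simp only: nf conf inj_image_eq_iff)
      then show False using that Top_Out_nf_val by blast
    qed
    then show ?thesis by blast
  qed
  have card_KF0: "card (KF0 n ?X ?\<tau>) = card (normal_forms n)"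
    unfolding KF0_eq using inj1 by (intro card_image) (auto simp: inj_on_def)
  have orbit: "{h ?A | h. h \<in> KF n ?X ?\<tau>} =
      (\<lambda>c. nf_op c ?A) ` normal_forms n \<union> (\<lambda>c. compl_nf_op c ?A) ` normal_forms n"
    unfolding KF_eq by blast
  have card_orbit: "card {h ?A | h. h \<in> KF n ?X ?\<tau>} = 2 * card (normal_forms n)"
    unfolding orbit using inj1 inj2 disj finite_normal_forms
    by (simp add: card_Un_disjoint card_image)
  \<comment> \<open>Two families of normal forms bound the monoid from above; evaluation at the
    marked set maps it onto the orbit and bounds it from below.\<close>
  have card_KF: "card (KF n ?X ?\<tau>) = 2 * card (normal_forms n)"
  proof (rule antisym)
    have "card (KF n ?X ?\<tau>) \<le> card (nf_op ` normal_forms n) + card (compl_nf_op ` normal_forms n)"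
      unfolding KF_eq by (rule card_Un_le)
    also have "\<dots> \<le> 2 * card (normal_forms n)"
      using card_image_le[OF finite_normal_forms, of nf_op n]
        card_image_le[OF finite_normal_forms, of compl_nf_op n] by linarith
    finally show "card (KF n ?X ?\<tau>) \<le> 2 * card (normal_forms n)" .
    have "finite (KF n ?X ?\<tau>)"
      unfolding KF_eq by (simp add: finite_normal_forms)
    then show "2 * card (normal_forms n) \<le> card (KF n ?X ?\<tau>)"
      unfolding card_orbit[symmetric] Setcompr_eq_image by (rule card_image_le)
  qed
  show ?thesis
  proof (intro exI conjI)
    show "n_topological_space n ?X ?\<tau>" "saturated n ?\<tau>" by (rule n_top, rule sat)
    show "?A \<subseteq> ?X" by (rule A)
    show "real (card (KF0 n ?X ?\<tau>)) = kf_poly n"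
      by (simp only: card_KF0 N)
    show "real (card (KF n ?X ?\<tau>)) = 2 * kf_poly n"
      "real (card {h ?A | h. h \<in> KF n ?X ?\<tau>}) = 2 * kf_poly n"
      by (simp_all only: card_KF card_orbit of_nat_mult of_nat_numeral N)
  qed
qed

end
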